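(* Let $\operatorname{char} k = 0$ and let $A = kQ/I$ be a quadratic string algebra such that $\mathcal{G}_n \neq \emptyset$ for some $n > 0$. Then the Lie bracket defined in $\mathrm{HH}^{*}(A)$ is non-trivial. More precisely, for any $s_1, s_2 \geq 1$ with $s_1 \neq s_2$: (i) if $n$ is even, then $[\mathrm{HH}^{s_1n+1}(A), \mathrm{HH}^{s_2n+1}(A)] \neq 0$; (ii) if $n$ is odd, then $[\mathrm{HH}^{2s_1n+1}(A), \mathrm{HH}^{2s_2n+1}(A)] \neq 0$.
   Context: Let $k$ be an algebraically closed field and $Q=(Q_0,Q_1,s,t)$ a finite connected quiver. Paths are written $\alpha_1\cdots\alpha_l$ with $t(\alpha_i)=s(\alpha_{i+1})$; $e_x$ is the trivial path at a vertex $x$. For arrows $\alpha,\beta$, "$\alpha\beta\in I$" (resp. "$\alpha\beta\notin I$") means $t(\alpha)=s(\beta)$ and the path $\alpha\beta$ lies (resp. does not lie) in $I$. A quadratic string algebra is $A=kQ/I$ where $I$ is an admissible ideal of $kQ$ ($F^m\subseteq I\subseteq F^2$ for some $m\ge 2$, $F$ the arrow ideal) generated by paths of length two, such that: (S1) each vertex is the source of at most two arrows and the target of at most two arrows; (S2) for each arrow $\alpha$ there is at most one arrow $\beta$ with $\alpha\beta\notin I$ and at most one arrow $\gamma$ with $\gamma\alpha\notin I$. Let $\mathcal{C}_n$ ($n\ge1$) be the set of pairs $(\alpha_1\cdots\alpha_n,e_{s(\alpha_1)})$ where $\alpha_1\cdots\alpha_n$ is an oriented cycle of $n$ arrows with $\alpha_i\alpha_{i+1}\in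 I$ for $1\le i<n$ and $\alpha_n\alpha_1\in I$. Put $\tau(\alpha_1\cdots\alpha_n,e_{s(\alpha_1)})=(\alpha_n\alpha_1\cdots\alpha_{n-1},e_{s(\alpha_n)})$. $\mathcal{C}_n(0)$ is the set of those pairs in $\mathcal{C}_n$ for which there is no arrow $\gamma\neq\alpha_n$ with $\gamma\alpha_1\in I$ and no arrow $\beta\ne\alpha_1$ with $\alpha_n\beta\in I$. $\mathcal{G}_n$ (gentle pairs) is the set of $w\in\mathcal{C}_n$ with $\tau^m(w)\in\mathcal{C}_n(0)$ for all $m\in\mathbb{Z}$. $\mathrm{HH}^n(A)=\mathrm{Ext}^n_{A-A}(A,A)$ and $\mathrm{HH}^*(A)=\bigoplus_{n\ge0}\mathrm{HH}^n(A)$. With $E=kQ_0$ and tensor products over $E$, the bar complex has cochains $\mathrm{Hom}_{E-E}(A^{\otimes n},A)$, and the (Gerstenhaber) Lie bracket is induced, for $f\in \mathrm{Hom}_{E-E}(A^{\otimes n},A)$ and $g\in \mathrm{Hom}_{E-E}(A^{\otimes m},A)$, by $[f,g]=f\circ g-(-1)^{(n-1)(m-1)}g\circ f\in\mathrm{Hom}_{E-E}(A^{\otimes n+m-1},A)$, where $f\circ g=\sum_{i=1}^n(-1)^{(i-1)(m-1)}f\circ_i g$ and $(f\circ_i g)(v_1\otimes\cdots\otimes v_{n+m-1})=f(v_1\otimes\cdots\otimes v_{i-1}\otimes g(v_i\otimes\cdots\otimes v_{i+m-1})\otimes v_{i+m}\otimes\cdots\otimes v_{n+m-1})$. "$[\mathrm{HH}^a(A),\mathrm{HH}^b(A)]\ne0$"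 means there are $u\in\mathrm{HH}^a(A)$, $v\in\mathrm{HH}^b(A)$ with $[u,v]\neq0$. *)

theory Defs
  imports
    "Graph_Theory.Graph_Theory"
    "HOL-Library.Poly_Mapping"
    "HOL-Computational_Algebra.Polynomial"
    "HOL-Algebra.Algebra"
begin

section \<open>Path algebras\<close>

text \<open>
  A quiver is a directed multigraph. A path is its starting vertex together with its list of
  arrows, read from left to right; \<open>(x, [])\<close> is the trivial path at \<open>x\<close>.
\<close>

type_synonym ('v, 'a) path = "'v \<times> 'a list"

definition quiver_paths :: "('v, 'a) pre_digraph \<Rightarrow> ('v, 'a) path set" where
  "quiver_paths Q = {(x, p). \<exists>y. pre_digraph.awalk Q x p y}"

definition path_source :: "('v, 'a) path \<Rightarrow> 'v" where
  "path_source p = fst p"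

definition path_target :: "('v, 'a) pre_digraph \<Rightarrow> ('v, 'a) path \<Rightarrow> 'v" where
  "path_target Q p = pre_digraph.awlast Q (fst p) (snd p)"

definition trivial_path :: "'v \<Rightarrow> ('v, 'a) path" where
  "trivial_path x = (x, [])"

definition arrows_path :: "('v, 'a) pre_digraph \<Rightarrow> 'a list \<Rightarrow> ('v, 'a) path" where
  "arrows_path Q as = (tail Q (hd as), as)"

definition path_algebra ::
  "('v, 'a) pre_digraph \<Rightarrow> (('v, 'a) path \<Rightarrow>\<^sub>0 'k::field) ring" where
  "path_algebra Q =
    \<lparr>carrier = {f. Poly_Mapping.keys f \<subseteq> quiver_paths Q},
     mult = (\<lambda>f g. \<Sum>p\<in>Poly_Mapping.keys f. \<Sum>q\<in>Poly_Mapping.keys g.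
       if path_target Q p = path_source q
       then Poly_Mapping.single (fst p, snd p @ snd q)
              (Poly_Mapping.lookup f p * Poly_Mapping.lookup g q)
       else 0),
     one = (\<Sum>x\<in>verts Q. Poly_Mapping.single (trivial_path x) 1),
     ring.zero = 0,
     ring.add = (+)\<rparr>"

definition path_elt :: "('v, 'a) path \<Rightarrow> (('v, 'a) path \<Rightarrow>\<^sub>0 'k::field)" where
  "path_elt p = Poly_Mapping.single p 1"

definition arrow_ideal ::
  "('v, 'a) pre_digraph \<Rightarrow> (('v, 'a) path \<Rightarrow>\<^sub>0 'k::field) set" where
  "arrow_ideal Q = Idl\<^bsub>path_algebra Q\<^esub> ((\<lambda>a. path_elt (arrows_path Q [a])) ` arcs Q)"

definition admissible ::
  "('v, 'a) pre_digraph \<Rightarrow> (('v, 'a) path \<Rightarrow>\<^sub>0 'k::field) set \<Rightarrow> bool" where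
  "admissible Q I \<longleftrightarrow> ideal I (path_algebra Q) \<and>
    (\<exists>m::nat. m \<ge> 2 \<and>
      arrow_ideal Q [^]\<^bsub>ideals_set (path_algebra Q)\<^esub> m \<subseteq> I \<and>
      I \<subseteq> arrow_ideal Q [^]\<^bsub>ideals_set (path_algebra Q)\<^esub> (2::nat))"

definition comp_in ::
  "('v, 'a) pre_digraph \<Rightarrow> (('v, 'a) path \<Rightarrow>\<^sub>0 'k::field) set \<Rightarrow> 'a \<Rightarrow> 'a \<Rightarrow> bool" where
  "comp_in Q I a b \<longleftrightarrow> a \<in> arcs Q \<and> b \<in> arcs Q \<and> head Q a = tail Q b \<and>
    path_elt (arrows_path Q [a, b]) \<in> I"

definition comp_notin ::
  "('v, 'a) pre_digraph \<Rightarrow> (('v, 'a) path \<Rightarrow>\<^sub>0 'k::field) set \<Rightarrow> 'a \<Rightarrow> 'a \<Rightarrow> bool" where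
  "comp_notin Q I a b \<longleftrightarrow> a \<in> arcs Q \<and> b \<in> arcs Q \<and> head Q a = tail Q b \<and>
    path_elt (arrows_path Q [a, b]) \<notin> I"


section \<open>Quadratic string algebras\<close>

locale quadratic_string_algebra = fin_digraph Q
  for Q :: "('v, 'a) pre_digraph" +
  fixes I :: "(('v, 'a) path \<Rightarrow>\<^sub>0 'k::field) set"
  assumes connected_quiver: "connected Q"
    and admissible_ideal: "admissible Q I"
    and quadratic_monomial:
      "\<exists>R \<subseteq> {p \<in> quiver_paths Q. length (snd p) = 2}. I = Idl\<^bsub>path_algebra Q\<^esub> (path_elt ` R)"
    and S1: "\<And>x. x \<in> verts Q \<Longrightarrow>
      card {a \<in> arcs Q. tail Q a = x} \<le> 2 \<and> card {a \<in> arcs Q. head Q a = x} \<le> 2"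
    and S2: "\<And>a. a \<in> arcs Q \<Longrightarrow>
      card {b \<in> arcs Q. comp_notin Q I a b} \<le> 1 \<and> card {c \<in> arcs Q. comp_notin Q I c a} \<le> 1"

definition quiver_algebra ::
  "('v, 'a) pre_digraph \<Rightarrow> (('v, 'a) path \<Rightarrow>\<^sub>0 'k::field) set \<Rightarrow>
    (('v, 'a) path \<Rightarrow>\<^sub>0 'k) set ring" where
  "quiver_algebra Q I = path_algebra Q Quot I"

text \<open>The image in \<open>kQ/I\<close> of the span \<open>kQ\<^sub>0\<close> of the trivial paths.\<close>

definition vertex_subring ::
  "('v, 'a) pre_digraph \<Rightarrow> (('v, 'a) path \<Rightarrow>\<^sub>0 'k::field) set \<Rightarrow>
    (('v, 'a) path \<Rightarrow>\<^sub>0 'k) set set" where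
  "vertex_subring Q I =
    (\<lambda>r. I +>\<^bsub>path_algebra Q\<^esub> r) ` {r. Poly_Mapping.keys r \<subseteq> trivial_path ` verts Q}"


section \<open>Gentle pairs\<close>

definition cycle_pair ::
  "('v, 'a) pre_digraph \<Rightarrow> 'a list \<Rightarrow> ('v, 'a) path \<times> ('v, 'a) path" where
  "cycle_pair Q as = (arrows_path Q as, trivial_path (tail Q (hd as)))"

definition cycle_pairs ::
  "('v, 'a) pre_digraph \<Rightarrow> (('v, 'a) path \<Rightarrow>\<^sub>0 'k::field) set \<Rightarrow> nat \<Rightarrow>
    (('v, 'a) path \<times> ('v, 'a) path) set" where
  "cycle_pairs Q I n = {cycle_pair Q as | as.
     n \<ge> 1 \<and> length as = n \<and>
     pre_digraph.awalk Q (tail Q (hd as)) as (tail Q (hd as)) \<and>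
     (\<forall>i. Suc i < n \<longrightarrow> comp_in Q I (as ! i) (as ! Suc i)) \<and>
     comp_in Q I (last as) (hd as)}"

definition cycle_rot ::
  "('v, 'a) pre_digraph \<Rightarrow> ('v, 'a) path \<times> ('v, 'a) path \<Rightarrow>
    ('v, 'a) path \<times> ('v, 'a) path" where
  "cycle_rot Q w = (let as = snd (fst w) in cycle_pair Q (last as # butlast as))"

text \<open>
  Integer powers of the rotation; it is a bijection only on each set of pairs of a given length,
  whence the relativised inverse.
\<close>

definition cycle_rot_pow ::
  "('v, 'a) pre_digraph \<Rightarrow> (('v, 'a) path \<Rightarrow>\<^sub>0 'k::field) set \<Rightarrow> nat \<Rightarrow> int \<Rightarrow>
    ('v, 'a) path \<times> ('v, 'a) path \<Rightarrow> ('v, 'a) path \<times> ('v, 'a) path" where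
  "cycle_rot_pow Q I n m =
    (if m \<ge> 0 then cycle_rot Q ^^ nat m
     else inv_into (cycle_pairs Q I n) (cycle_rot Q) ^^ nat (- m))"

definition cycle_pairs0 ::
  "('v, 'a) pre_digraph \<Rightarrow> (('v, 'a) path \<Rightarrow>\<^sub>0 'k::field) set \<Rightarrow> nat \<Rightarrow>
    (('v, 'a) path \<times> ('v, 'a) path) set" where
  "cycle_pairs0 Q I n = {w \<in> cycle_pairs Q I n. let as = snd (fst w) in
     \<not> (\<exists>c \<in> arcs Q. c \<noteq> last as \<and> comp_in Q I c (hd as)) \<and>
     \<not> (\<exists>b \<in> arcs Q. b \<noteq> hd as \<and> comp_in Q I (last as) b)}"

definition gentle_pairs ::
  "('v, 'a) pre_digraph \<Rightarrow> (('v, 'a) path \<Rightarrow>\<^sub>0 'k::field) set \<Rightarrow> nat \<Rightarrow>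
    (('v, 'a) path \<times> ('v, 'a) path) set" where
  "gentle_pairs Q I n =
    {w \<in> cycle_pairs Q I n. \<forall>m::int. cycle_rot_pow Q I n m w \<in> cycle_pairs0 Q I n}"


section \<open>Hochschild cohomology and the Gerstenhaber bracket\<close>

text \<open>
  Throughout, \<open>A\<close> is a ring and \<open>E\<close> a subring of \<open>A\<close>; the bar complex is taken relative to \<open>E\<close>.
  If \<open>E\<close> contains the scalars, as \<open>kQ\<^sub>0\<close> does, then all the maps below are \<open>k\<close>-multilinear.
\<close>

definition tuples :: "('r, 'c) ring_scheme \<Rightarrow> nat \<Rightarrow> 'r list set" where
  "tuples A n = {xs. length xs = n \<and> set xs \<subseteq> carrier A}"

text \<open>
  The \<open>E\<close>-bimodule maps from the \<open>n\<close>-fold tensor power of \<open>A\<close> over \<open>E\<close> to \<open>A\<close>, given by the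
  corresponding \<open>E\<close>-balanced multiadditive maps on \<open>n\<close>-tuples. The tensor power for \<open>n = 0\<close>
  is \<open>E\<close>, and a bimodule map \<open>E \<rightarrow> A\<close> is given by the image of the unit, an element
  of \<open>A\<close> that commutes with \<open>E\<close>.
\<close>

definition cochains :: "('r, 'c) ring_scheme \<Rightarrow> 'r set \<Rightarrow> nat \<Rightarrow> ('r list \<Rightarrow> 'r) set" where
  "cochains A E n = {f \<in> tuples A n \<rightarrow>\<^sub>E carrier A.
     (\<forall>xs ys. \<forall>a \<in> carrier A. \<forall>b \<in> carrier A.
        xs @ a # ys \<in> tuples A n \<longrightarrow>
        f (xs @ (a \<oplus>\<^bsub>A\<^esub> b) # ys) = f (xs @ a # ys) \<oplus>\<^bsub>A\<^esub> f (xs @ b # ys)) \<and>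
     (\<forall>xs a b ys. \<forall>r \<in> E.
        xs @ a # b # ys \<in> tuples A n \<longrightarrow>
        f (xs @ (a \<otimes>\<^bsub>A\<^esub> r) # b # ys) = f (xs @ a # (r \<otimes>\<^bsub>A\<^esub> b) # ys)) \<and>
     (\<forall>a ys. \<forall>r \<in> E.
        a # ys \<in> tuples A n \<longrightarrow> f ((r \<otimes>\<^bsub>A\<^esub> a) # ys) = r \<otimes>\<^bsub>A\<^esub> f (a # ys)) \<and>
     (\<forall>xs a. \<forall>r \<in> E.
        xs @ [a] \<in> tuples A n \<longrightarrow> f (xs @ [a \<otimes>\<^bsub>A\<^esub> r]) = f (xs @ [a]) \<otimes>\<^bsub>A\<^esub> r) \<and>
     (n = 0 \<longrightarrow> (\<forall>r \<in> E. r \<otimes>\<^bsub>A\<^esub> f [] = f [] \<otimes>\<^bsub>A\<^esub> r))}"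

text \<open>
  The additive groups of cochains are written as (multiplicative) HOL-Algebra groups, so that
  cosets, quotients and direct sums of groups from there are available.
\<close>

definition cochain_group ::
  "('r, 'c) ring_scheme \<Rightarrow> 'r set \<Rightarrow> nat \<Rightarrow> ('r list \<Rightarrow> 'r) monoid" where
  "cochain_group A E n =
    \<lparr>carrier = cochains A E n,
     mult = (\<lambda>f g. \<lambda>xs\<in>tuples A n. f xs \<oplus>\<^bsub>A\<^esub> g xs),
     one = (\<lambda>xs\<in>tuples A n. \<zero>\<^bsub>A\<^esub>)\<rparr>"

text \<open>\<open>signed A e x\<close> is \<open>(-1)\<close> to the power \<open>e\<close>, times \<open>x\<close>.\<close>

definition signed :: "('r, 'c) ring_scheme \<Rightarrow> int \<Rightarrow> 'r \<Rightarrow> 'r" where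
  "signed A e x = (if even e then x else \<ominus>\<^bsub>A\<^esub> x)"

definition hochschild_d ::
  "('r, 'c) ring_scheme \<Rightarrow> nat \<Rightarrow> ('r list \<Rightarrow> 'r) \<Rightarrow> ('r list \<Rightarrow> 'r)" where
  "hochschild_d A n f = (\<lambda>xs\<in>tuples A (Suc n).
     hd xs \<otimes>\<^bsub>A\<^esub> f (tl xs)
     \<oplus>\<^bsub>A\<^esub> (\<Oplus>\<^bsub>A\<^esub>i\<in>{1..n}. signed A (int i)
            (f (take (i - 1) xs @ [xs ! (i - 1) \<otimes>\<^bsub>A\<^esub> xs ! i] @ drop (i + 1) xs)))
     \<oplus>\<^bsub>A\<^esub> signed A (int n + 1) (f (butlast xs) \<otimes>\<^bsub>A\<^esub> last xs))"

definition cocycles :: "('r, 'c) ring_scheme \<Rightarrow> 'r set \<Rightarrow> nat \<Rightarrow> ('r list \<Rightarrow> 'r) set" where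
  "cocycles A E n =
    kernel (cochain_group A E n) (cochain_group A E (Suc n)) (hochschild_d A n)"

definition coboundaries :: "('r, 'c) ring_scheme \<Rightarrow> 'r set \<Rightarrow> nat \<Rightarrow> ('r list \<Rightarrow> 'r) set" where
  "coboundaries A E n =
    (case n of 0 \<Rightarrow> {\<one>\<^bsub>cochain_group A E 0\<^esub>}
     | Suc m \<Rightarrow> hochschild_d A m ` cochains A E m)"

definition HH ::
  "('r, 'c) ring_scheme \<Rightarrow> 'r set \<Rightarrow> nat \<Rightarrow> ('r list \<Rightarrow> 'r) set monoid" where
  "HH A E n = ((cochain_group A E n)\<lparr>carrier := cocycles A E n\<rparr>) Mod coboundaries A E n"

definition HH_star ::
  "('r, 'c) ring_scheme \<Rightarrow> 'r set \<Rightarrow> (nat \<Rightarrow> ('r list \<Rightarrow> 'r) set) monoid" where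
  "HH_star A E = sum_group UNIV (HH A E)"

text \<open>
  \<open>circ_i A n m i f g\<close> inserts \<open>g\<close>, of degree \<open>m\<close>, into the \<open>i\<close>-th argument
  (\<open>1 \<le> i \<le> n\<close>) of \<open>f\<close>, of degree \<open>n\<close>.
\<close>

definition circ_i ::
  "('r, 'c) ring_scheme \<Rightarrow> nat \<Rightarrow> nat \<Rightarrow> nat \<Rightarrow>
    ('r list \<Rightarrow> 'r) \<Rightarrow> ('r list \<Rightarrow> 'r) \<Rightarrow> ('r list \<Rightarrow> 'r)" where
  "circ_i A n m i f g = (\<lambda>xs\<in>tuples A (n + m - 1).
     f (take (i - 1) xs @ [g (take m (drop (i - 1) xs))] @ drop (i - 1 + m) xs))"

definition circ ::
  "('r, 'c) ring_scheme \<Rightarrow> nat \<Rightarrow> nat \<Rightarrow>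
    ('r list \<Rightarrow> 'r) \<Rightarrow> ('r list \<Rightarrow> 'r) \<Rightarrow> ('r list \<Rightarrow> 'r)" where
  "circ A n m f g = (\<lambda>xs\<in>tuples A (n + m - 1).
     \<Oplus>\<^bsub>A\<^esub>i\<in>{1..n}. signed A ((int i - 1) * (int m - 1)) (circ_i A n m i f g xs))"

text \<open>For \<open>n = m = 0\<close>, where the degree \<open>n + m - 1\<close> is truncated, this is zero.\<close>

definition cochain_bracket ::
  "('r, 'c) ring_scheme \<Rightarrow> nat \<Rightarrow> nat \<Rightarrow>
    ('r list \<Rightarrow> 'r) \<Rightarrow> ('r list \<Rightarrow> 'r) \<Rightarrow> ('r list \<Rightarrow> 'r)" where
  "cochain_bracket A n m f g = (\<lambda>xs\<in>tuples A (n + m - 1).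
     circ A n m f g xs \<ominus>\<^bsub>A\<^esub> signed A ((int n - 1) * (int m - 1)) (circ A m n g f xs))"

text \<open>
  The induced brackets on cohomology classes. As for the product of cosets in a factor ring, the
  class of the result is the union of the classes obtained from all choices of representatives;
  these classes coincide.
\<close>

definition HH_bracket ::
  "('r, 'c) ring_scheme \<Rightarrow> 'r set \<Rightarrow> nat \<Rightarrow> nat \<Rightarrow>
    ('r list \<Rightarrow> 'r) set \<Rightarrow> ('r list \<Rightarrow> 'r) set \<Rightarrow> ('r list \<Rightarrow> 'r) set" where
  "HH_bracket A E n m U V =
    (\<Union>f\<in>U. \<Union>g\<in>V. coboundaries A E (n + m - 1)
       #>\<^bsub>cochain_group A E (n + m - 1)\<^esub> cochain_bracket A n m f g)"

text \<open>
  The bilinear extension to the direct sum: the component of \<open>[u, v]\<close> in degree \<open>n\<close> is the class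
  of the sum of the brackets of the components of \<open>u\<close> and \<open>v\<close> in degrees \<open>a\<close> and \<open>b\<close>
  with \<open>a + b - 1 = n\<close>.
\<close>

definition HH_star_bracket ::
  "('r, 'c) ring_scheme \<Rightarrow> 'r set \<Rightarrow>
    (nat \<Rightarrow> ('r list \<Rightarrow> 'r) set) \<Rightarrow> (nat \<Rightarrow> ('r list \<Rightarrow> 'r) set) \<Rightarrow>
    (nat \<Rightarrow> ('r list \<Rightarrow> 'r) set)" where
  "HH_star_bracket A E u v = (\<lambda>n.
     \<Union>f\<in>Pi UNIV u. \<Union>g\<in>Pi UNIV v. coboundaries A E n #>\<^bsub>cochain_group A E n\<^esub>
       finprod (cochain_group A E n) (\<lambda>(a, b). cochain_bracket A a b (f a) (g b))
         {(a, b). a + b = Suc n})"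

definition HH_bracket_nonzero ::
  "('r, 'c) ring_scheme \<Rightarrow> 'r set \<Rightarrow> nat \<Rightarrow> nat \<Rightarrow> bool" where
  "HH_bracket_nonzero A E a b \<longleftrightarrow>
    (\<exists>u \<in> carrier (HH A E a). \<exists>v \<in> carrier (HH A E b).
       HH_bracket A E a b u v \<noteq> \<one>\<^bsub>HH A E (a + b - 1)\<^esub>)"

definition HH_star_bracket_nontrivial :: "('r, 'c) ring_scheme \<Rightarrow> 'r set \<Rightarrow> bool" where
  "HH_star_bracket_nontrivial A E \<longleftrightarrow>
    (\<exists>u \<in> carrier (HH_star A E). \<exists>v \<in> carrier (HH_star A E).
       HH_star_bracket A E u v \<noteq> \<one>\<^bsub>HH_star A E\<^esub>)"

end

theory Submission
  imports Defs
begin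

text \<open>
  The degree \<open>m\<close> part of the minimal bimodule resolution of a quadratic monomial algebra
  \<open>A = kQ/I\<close> is spanned by the chains of \<open>m\<close> arrows all of whose consecutive products are
  relations. A cycle \<open>a\<^sub>0 \<dots> a\<^bsub>p-1\<^esub>\<close> of distinct arrows with all cyclically consecutive products in
  \<open>I\<close> therefore gives, for every \<open>t \<ge> 1\<close>, a cochain of degree \<open>tp + 1\<close> on this resolution: it
  sends the chain that starts with \<open>a\<^sub>0\<close>, runs \<open>t\<close> times round the cycle and ends with \<open>a\<^sub>0\<close>
  again to the arrow \<open>a\<^sub>0\<close>, and all other chains to \<open>0\<close>. It is a cocycle, because a chain can only be
  prolonged by an arrow whose product with \<open>a\<^sub>0\<close> is a relation. The theorem reflects the identity
  \<open>[f\<^sub>s, f\<^sub>t] = (s - t) f\<^bsub>s+t\<^esub>\<close> for these cocycles when \<open>sp\<close> and \<open>tp\<close> are even: the word of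
  \<open>f\<^sub>s\<close> contains \<open>a\<^sub>0\<close> exactly \<open>s + 1\<close> times, so \<open>f\<^sub>t\<close> can be inserted in \<open>s + 1\<close> places,
  always with sign \<open>+1\<close>, and vice versa.

  To make this precise on the bar complex two things are needed.

  \<^item> The cocycle has to be transported to the bar complex. The comparison map sends the cochain
    \<open>w\<^sub>1 \<dots> w\<^sub>m \<mapsto> \<alpha>\<close>, where \<open>w\<^sub>1 = w\<^sub>m = \<alpha>\<close> and \<open>m \<ge> 2\<close>, to the cochain that is nonzero on
    a tuple of paths only if it is of the form \<open>(u\<alpha>, w\<^sub>2, \<dots>, w\<^bsub>m-1\<^esub>, \<alpha>v)\<close>, where its value is
    \<open>u\<alpha>v\<close>. This cochain makes sense already on the free path algebra \<open>kQ\<close>: it is a product of the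
    part of the first argument supported on paths ending in \<open>\<alpha>\<close>, of arrow coefficients of the
    middle arguments, and of the left quotient of the last argument by \<open>\<alpha>\<close>. Each factor obeys
    a twisted Leibniz rule (\<open>ending_part_mult\<close>, \<open>arrow_coeff_mult\<close>, \<open>left_quotient_mult\<close>), so
    the alternating sum in the Hochschild differential telescopes (\<open>word_cochain_telescopes\<close>), and
    since \<open>I\<close> is spanned by paths, the cochain descends to \<open>A\<close> (\<open>word_cochain_descends\<close>).

  \<^item> The bracket has to be separated from the coboundaries. For this the functional \<open>cycle_trace\<close>
    adds up, over the rotations of the cycle, the coefficient of \<open>a\<^sub>i\<close> in the value on the tuple
    \<open>(a\<^sub>i, a\<^bsub>i+1\<^esub>, \<dots>, a\<^sub>i)\<close>. Consecutive arrows multiply to zero in \<open>A\<close>, so only the two outer terms of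
    a coboundary survive on such a tuple, and they cancel in the sum over the rotations
    (\<open>cycle_trace_coboundary\<close>). On the bracket the functional takes the value \<open>s - t\<close>
    (\<open>cycle_trace_bracket\<close>), which is nonzero in characteristic \<open>0\<close>.

  The cycle underlying a gentle pair may repeat itself, but gentleness makes every arrow on
  it determine its successor; so it is a power of a cycle of distinct arrows whose length \<open>p\<close>
  divides \<open>n\<close>, and degrees of the form \<open>sn + 1\<close> are also of the form \<open>s'p + 1\<close>.
\<close>

(* The symbol also joins vertex walks; below it is addition in a ring. *)
no_notation vwalk_join (infixr \<open>\<oplus>\<close> 65)

section \<open>Relative Hochschild cochains and their bracket\<close>

lemma tuples_iff: "xs \<in> tuples A n \<longleftrightarrow> length xs = n \<and> set xs \<subseteq> carrier A"
  by (simp add: tuples_def)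

text \<open>
  Inserting one cochain into another cuts the arguments into three blocks. Every axiom of cochains
  speaks about one marked argument, which lies in one of these blocks.
\<close>

lemma append_Cons_split3:
  assumes "length (xs @ a # ys) = p + m + s"
  obtains (before) P M S where "ys = P @ M @ S" "length xs + 1 + length P = p" "length M = m" "length S = s"
  | (inside) P M1 M2 S where "xs = P @ M1" "ys = M2 @ S" "length P = p"
      "length M1 + 1 + length M2 = m" "length S = s"
  | (after) P M S where "xs = P @ M @ S" "length P = p" "length M = m" "length S + 1 + length ys = s"
proof -
  have three: "zs = take k zs @ take m (drop k zs) @ drop m (drop k zs)" for k and zs :: "'a list"
    by (simp only: append_take_drop_id)
  consider "length xs < p" | "p \<le> length xs" "length xs < p + m" | "p + m \<le> length xs" by linarith
  then show thesis
  proof cases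
    case 1
    show thesis
      by (rule before[OF three[of _ "p - length xs - 1"]]) (use assms 1 in simp_all)
  next
    case 2
    let ?k = "p + m - length xs - 1"
    show thesis
      by (rule inside[of "take p xs" "drop p xs" "take ?k ys" "drop ?k ys"]) (use assms 2 in simp_all)
  next
    case 3
    show thesis
      by (rule after[OF three[of _ p]]) (use assms 3 in simp_all)
  qed
qed

locale ring_with_subset = ring A for A (structure) +
  fixes E :: "'a set"
  assumes E_subset: "E \<subseteq> carrier A"
begin

lemma in_carrier_if_in_E [simp]: "r \<in> E \<Longrightarrow> r \<in> carrier A"
  using E_subset by blast

lemma signed_closed [simp]: "x \<in> carrier A \<Longrightarrow> signed A e x \<in> carrier A"
  by (simp add: signed_def)

lemma signed_zero [simp]: "signed A e \<zero> = \<zero>"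
  by (simp add: signed_def)

lemma cochainsI:
  assumes "f \<in> tuples A n \<rightarrow>\<^sub>E carrier A"
    and "\<And>xs a b ys. \<lbrakk>xs @ a # ys \<in> tuples A n; a \<in> carrier A; b \<in> carrier A\<rbrakk> \<Longrightarrow>
        f (xs @ (a \<oplus> b) # ys) = f (xs @ a # ys) \<oplus> f (xs @ b # ys)"
    and "\<And>xs a b ys r. \<lbrakk>r \<in> E; xs @ a # b # ys \<in> tuples A n\<rbrakk> \<Longrightarrow>
        f (xs @ (a \<otimes> r) # b # ys) = f (xs @ a # (r \<otimes> b) # ys)"
    and "\<And>a ys r. \<lbrakk>r \<in> E; a # ys \<in> tuples A n\<rbrakk> \<Longrightarrow> f ((r \<otimes> a) # ys) = r \<otimes> f (a # ys)"
    and "\<And>xs a r. \<lbrakk>r \<in> E; xs @ [a] \<in> tuples A n\<rbrakk> \<Longrightarrow> f (xs @ [a \<otimes> r]) = f (xs @ [a]) \<otimes> r"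
    and "\<And>r. \<lbrakk>n = 0; r \<in> E\<rbrakk> \<Longrightarrow> r \<otimes> f [] = f [] \<otimes> r"
  shows "f \<in> cochains A E n"
  using assms by (simp add: cochains_def)

lemma cochain_funcset: "f \<in> cochains A E n \<Longrightarrow> f \<in> tuples A n \<rightarrow>\<^sub>E carrier A"
  by (simp add: cochains_def)

lemma cochain_closed:
  "f \<in> cochains A E n \<Longrightarrow> length xs = n \<Longrightarrow> set xs \<subseteq> carrier A \<Longrightarrow> f xs \<in> carrier A"
  by (auto simp: cochains_def tuples_iff)

lemma cochain_additive:
  "\<lbrakk>f \<in> cochains A E n; length (xs @ a # ys) = n; set xs \<subseteq> carrier A; a \<in> carrier A;
    b \<in> carrier A; set ys \<subseteq> carrier A\<rbrakk> \<Longrightarrow>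
    f (xs @ (a \<oplus> b) # ys) = f (xs @ a # ys) \<oplus> f (xs @ b # ys)"
  by (simp add: cochains_def tuples_iff)

lemma cochain_balanced:
  "\<lbrakk>f \<in> cochains A E n; length (xs @ a # b # ys) = n; r \<in> E; set xs \<subseteq> carrier A; a \<in> carrier A;
    b \<in> carrier A; set ys \<subseteq> carrier A\<rbrakk> \<Longrightarrow>
    f (xs @ (a \<otimes> r) # b # ys) = f (xs @ a # (r \<otimes> b) # ys)"
  by (simp add: cochains_def tuples_iff)

lemma cochain_left:
  "\<lbrakk>f \<in> cochains A E n; length (a # ys) = n; r \<in> E; a \<in> carrier A; set ys \<subseteq> carrier A\<rbrakk> \<Longrightarrow>
    f ((r \<otimes> a) # ys) = r \<otimes> f (a # ys)"
  by (simp add: cochains_def tuples_iff)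

lemma cochain_right:
  "\<lbrakk>f \<in> cochains A E n; length (xs @ [a]) = n; r \<in> E; a \<in> carrier A; set xs \<subseteq> carrier A\<rbrakk> \<Longrightarrow>
    f (xs @ [a \<otimes> r]) = f (xs @ [a]) \<otimes> r"
  by (simp add: cochains_def tuples_iff)

lemma cochain_central: "\<lbrakk>f \<in> cochains A E n; n = 0; r \<in> E\<rbrakk> \<Longrightarrow> r \<otimes> f [] = f [] \<otimes> r"
  by (simp add: cochains_def)

lemma cochain_eq_zero:
  assumes f: "f \<in> cochains A E n"
    and l: "length (xs @ \<zero> # ys) = n" "set xs \<subseteq> carrier A" "set ys \<subseteq> carrier A"
  shows "f (xs @ \<zero> # ys) = \<zero>"
proof -
  have c: "f (xs @ \<zero> # ys) \<in> carrier A"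
    by (rule cochain_closed[OF f]) (use l in auto)
  have "f (xs @ \<zero> # ys) \<oplus> f (xs @ \<zero> # ys) = f (xs @ \<zero> # ys)"
    using cochain_additive[OF f, of xs \<zero> ys \<zero>] l by simp
  then show ?thesis
    using add.l_cancel_one[OF c c] by simp
qed

lemma cochains_add:
  assumes f: "f \<in> cochains A E n" and g: "g \<in> cochains A E n"
  shows "(\<lambda>xs\<in>tuples A n. f xs \<oplus> g xs) \<in> cochains A E n"
  by (rule cochainsI)
    (auto simp: tuples_iff cochain_closed[OF f] cochain_closed[OF g] cochain_additive[OF f] a_ac
        cochain_additive[OF g] cochain_balanced[OF f] cochain_balanced[OF g] cochain_left[OF f]
        cochain_left[OF g] cochain_right[OF f] cochain_right[OF g] r_distr l_distr
        cochain_central[OF f] cochain_central[OF g])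

lemma cochains_minus:
  assumes f: "f \<in> cochains A E n"
  shows "(\<lambda>xs\<in>tuples A n. \<ominus> f xs) \<in> cochains A E n"
  by (rule cochainsI)
    (auto simp: tuples_iff cochain_closed[OF f] cochain_additive[OF f] minus_add a_ac
        cochain_balanced[OF f] cochain_left[OF f] cochain_right[OF f] r_minus l_minus
        cochain_central[OF f])

lemma cochains_zero: "(\<lambda>xs\<in>tuples A n. \<zero>) \<in> cochains A E n"
  by (rule cochainsI) (auto simp: tuples_iff)

lemma cochains_signed:
  assumes f: "f \<in> cochains A E n"
  shows "(\<lambda>xs\<in>tuples A n. signed A e (f xs)) \<in> cochains A E n"
proof (cases "even e")
  case True
  then have "(\<lambda>xs\<in>tuples A n. signed A e (f xs)) = f"
    using cochain_funcset[OF f] by (auto simp: signed_def fun_eq_iff PiE_def extensional_def)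
  then show ?thesis using f by simp
next
  case False
  then show ?thesis using cochains_minus[OF f] by (simp add: signed_def)
qed

lemma cochains_finsum:
  assumes "finite J" and "\<And>i. i \<in> J \<Longrightarrow> f i \<in> cochains A E n"
  shows "(\<lambda>xs\<in>tuples A n. \<Oplus>i\<in>J. f i xs) \<in> cochains A E n"
  using assms
proof (induction J)
  case empty
  then show ?case using cochains_zero[of n] by (simp only: finsum_empty)
next
  case (insert j J)
  have "(\<lambda>xs\<in>tuples A n. \<Oplus>i\<in>insert j J. f i xs) =
      (\<lambda>xs\<in>tuples A n. f j xs \<oplus> (\<lambda>xs\<in>tuples A n. \<Oplus>i\<in>J. f i xs) xs)"
  proof (rule restrict_ext)
    fix xs assume xs: "xs \<in> tuples A n"
    then have "\<And>i. i \<in> insert j J \<Longrightarrow> f i xs \<in> carrier A"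
      using insert.prems cochain_closed by (auto simp: tuples_iff)
    then show "(\<Oplus>i\<in>insert j J. f i xs) = f j xs \<oplus> (\<lambda>xs\<in>tuples A n. \<Oplus>i\<in>J. f i xs) xs"
      using insert.hyps xs by (simp add: finsum_insert Pi_def)
  qed
  moreover have "(\<lambda>xs\<in>tuples A n. f j xs \<oplus> (\<lambda>xs\<in>tuples A n. \<Oplus>i\<in>J. f i xs) xs) \<in> cochains A E n"
    by (rule cochains_add) (use insert in auto)
  ultimately show ?case by (simp only:)
qed

lemma circ_i_append:
  assumes "length P = i - 1" "length M = m" "length S = n - i" "1 \<le> i" "i \<le> n"
    "set P \<subseteq> carrier A" "set M \<subseteq> carrier A" "set S \<subseteq> carrier A"
  shows "circ_i A n m i f g (P @ M @ S) = f (P @ g M # S)"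
  using assms by (simp add: circ_i_def tuples_iff add.commute)

text \<open>
  If the marked arguments lie in different blocks, balancedness of the insertion follows from that of
  the outer cochain together with one-sided linearity of the inner one; if the arguments lie in the
  same block, one of the two cochains alone is responsible. A positive degree of the inner cochain
  guarantees that its block is not empty.
\<close>

lemma circ_i_cochain:
  assumes f: "f \<in> cochains A E n" and g: "g \<in> cochains A E m"
    and i: "1 \<le> i" "i \<le> n" and m: "1 \<le> m"
  shows "circ_i A n m i f g \<in> cochains A E (n + m - 1)"
proof -
  define p where "p = i - 1"
  define s where "s = n - i"
  define h where "h = circ_i A n m i f g"
  have n: "n = p + 1 + s" and N: "n + m - 1 = p + m + s"
    using i m by (auto simp: p_def s_def)
  have gc: "g M \<in> carrier A" if "length M = m" "set M \<subseteq> carrier A" for M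
    using cochain_closed[OF g] that by auto
  have fc: "f (P @ x # S) \<in> carrier A" if "length P = p" "length S = s" "x \<in> carrier A"
    "set P \<subseteq> carrier A" "set S \<subseteq> carrier A" for P x S
    using cochain_closed[OF f] that n by auto
  have h: "h (P @ M @ S) = f (P @ g M # S)"
    if "length P = p" "length M = m" "length S = s" "set P \<subseteq> carrier A" "set M \<subseteq> carrier A"
      "set S \<subseteq> carrier A" for P M S
    unfolding h_def by (rule circ_i_append) (use that i in \<open>auto simp: p_def s_def\<close>)
  have "h \<in> cochains A E (n + m - 1)"
  proof (rule cochainsI)
    show "h \<in> tuples A (n + m - 1) \<rightarrow>\<^sub>E carrier A"
    proof (rule PiE_I)
      fix xs assume xs: "xs \<in> tuples A (n + m - 1)"
      have sub: "set (take p xs) \<subseteq> carrier A" "set (take m (drop p xs)) \<subseteq> carrier A"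
        "set (drop (p + m) xs) \<subseteq> carrier A"
        using xs set_take_subset set_drop_subset unfolding tuples_iff by (metis dual_order.trans)+
      have "h xs = f (take p xs @ g (take m (drop p xs)) # drop (p + m) xs)"
        using xs by (simp add: h_def circ_i_def p_def add.commute)
      moreover have "\<dots> \<in> carrier A"
        by (intro fc gc) (use sub xs N in \<open>auto simp: tuples_iff\<close>)
      ultimately show "h xs \<in> carrier A" by simp
    next
      fix xs assume "xs \<notin> tuples A (n + m - 1)"
      then show "h xs = undefined" by (simp add: h_def circ_i_def)
    qed
  next
    fix xs a b ys
    assume t: "xs @ a # ys \<in> tuples A (n + m - 1)" and ab: "a \<in> carrier A" "b \<in> carrier A"
    have "length (xs @ a # ys) = p + m + s" using t unfolding N by (simp add: tuples_iff)
    then show "h (xs @ (a \<oplus> b) # ys) = h (xs @ a # ys) \<oplus> h (xs @ b # ys)"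
    proof (cases rule: append_Cons_split3)
      case (before P M S)
      then have "h (xs @ x # ys) = f (xs @ x # P @ g M # S)" if "x \<in> carrier A" for x
        using h[of "xs @ x # P" M S] t that by (simp add: tuples_iff)
      then show ?thesis
        using ab t before n gc[of M] by (simp add: tuples_iff cochain_additive[OF f])
    next
      case (inside P M1 M2 S)
      then have "h (xs @ x # ys) = f (P @ g (M1 @ x # M2) # S)" if "x \<in> carrier A" for x
        using h[of P "M1 @ x # M2" S] t that by (simp add: tuples_iff)
      then show ?thesis
        using ab t inside n
        by (simp add: tuples_iff cochain_additive[OF f] cochain_additive[OF g] gc)
    next
      case (after P M S)
      then have "h (xs @ x # ys) = f (P @ g M # S @ x # ys)" if "x \<in> carrier A" for x
        using h[of P M "S @ x # ys"] t that by (simp add: tuples_iff)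
      then show ?thesis
        using ab t after n gc[of M] cochain_additive[OF f, of "P @ g M # S" a ys b]
        by (simp add: tuples_iff)
    qed
  next
    fix xs a b ys r
    assume r: "r \<in> E" and t: "xs @ a # b # ys \<in> tuples A (n + m - 1)"
    then have ab: "a \<in> carrier A" "b \<in> carrier A" by (auto simp: tuples_iff)
    have "length (xs @ a # (b # ys)) = p + m + s"
      using t unfolding N by (simp add: tuples_iff)
    then show "h (xs @ (a \<otimes> r) # b # ys) = h (xs @ a # (r \<otimes> b) # ys)"
    proof (cases rule: append_Cons_split3)
      case (before P M S)
      show ?thesis
      proof (cases P)
        case Nil
        then obtain M' where M: "M = b # M'" "ys = M' @ S"
          using before m by (cases M) auto
        have "h (xs @ x # y # ys) = f (xs @ x # g (y # M') # S)" if "x \<in> carrier A" "y \<in> carrier A" for x y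
          using h[of "xs @ [x]" "y # M'" S] t that M before Nil by (simp add: tuples_iff)
        then show ?thesis
          using ab t before n r M Nil gc[of "b # M'"]
          by (simp add: tuples_iff cochain_balanced[OF f] cochain_left[OF g])
      next
        case (Cons b' P')
        then have "h (xs @ x # y # ys) = f (xs @ x # y # P' @ g M # S)" if "x \<in> carrier A" "y \<in> carrier A" for x y
          using h[of "xs @ x # y # P'" M S] t that before by (simp add: tuples_iff)
        then show ?thesis
          using ab t before n gc[of M] Cons r by (simp add: tuples_iff cochain_balanced[OF f])
      qed
    next
      case (inside P M1 M2 S)
      show ?thesis
      proof (cases M2)
        case Nil
        then have "h (xs @ x # y # ys) = f (P @ g (M1 @ [x]) # y # ys)" if "x \<in> carrier A" "y \<in> carrier A" for x y
          using h[of P "M1 @ [x]" "y # ys"] t that inside by (auto simp: tuples_iff)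
        from this[of "a \<otimes> r" b] this[of a "r \<otimes> b"] show ?thesis
          using ab t inside n Nil r gc[of "M1 @ [a]"]
          by (auto simp: tuples_iff cochain_right[OF g] cochain_balanced[OF f])
      next
        case (Cons b' M2')
        then have "h (xs @ x # y # ys) = f (P @ g (M1 @ x # y # M2') # S)" if "x \<in> carrier A" "y \<in> carrier A" for x y
          using h[of P "M1 @ x # y # M2'" S] t that inside by (simp add: tuples_iff)
        then show ?thesis
          using ab t inside n Cons r by (simp add: tuples_iff cochain_balanced[OF g])
      qed
    next
      case (after P M S)
      then have "h (xs @ x # y # ys) = f (P @ g M # S @ x # y # ys)" if "x \<in> carrier A" "y \<in> carrier A" for x y
        using h[of P M "S @ x # y # ys"] t that by (simp add: tuples_iff)
      then show ?thesis
        using ab t after n gc[of M] r cochain_balanced[OF f, of "P @ g M # S" a b ys r]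
        by (simp add: tuples_iff)
    qed
  next
    fix a ys r
    assume r: "r \<in> E" and t: "a # ys \<in> tuples A (n + m - 1)"
    then have a: "a \<in> carrier A" by (auto simp: tuples_iff)
    have "length ([] @ a # ys) = p + m + s" using t unfolding N by (simp add: tuples_iff)
    then show "h ((r \<otimes> a) # ys) = r \<otimes> h (a # ys)"
    proof (cases rule: append_Cons_split3)
      case (before P M S)
      then have "h (x # ys) = f (x # P @ g M # S)" if "x \<in> carrier A" for x
        using h[of "x # P" M S] t that by (simp add: tuples_iff)
      then show ?thesis
        using a t before n gc[of M] r by (simp add: tuples_iff cochain_left[OF f])
    next
      case (inside P M1 M2 S)
      then have "h (x # ys) = f (g (x # M2) # S)" if "x \<in> carrier A" for x
        using h[of "[]" "x # M2" S] t that by (simp add: tuples_iff)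
      then show ?thesis
        using a t inside n gc[of "a # M2"] r
        by (simp add: tuples_iff cochain_left[OF f] cochain_left[OF g])
    next
      case (after P M S)
      then show ?thesis using m by simp
    qed
  next
    fix xs a r
    assume r: "r \<in> E" and t: "xs @ [a] \<in> tuples A (n + m - 1)"
    then have a: "a \<in> carrier A" by (auto simp: tuples_iff)
    have "length (xs @ a # []) = p + m + s" using t unfolding N by (simp add: tuples_iff)
    then show "h (xs @ [a \<otimes> r]) = h (xs @ [a]) \<otimes> r"
    proof (cases rule: append_Cons_split3)
      case (before P M S)
      then show ?thesis using m by simp
    next
      case (inside P M1 M2 S)
      then have "h (xs @ [x]) = f (P @ [g (M1 @ [x])])" if "x \<in> carrier A" for x
        using h[of P "M1 @ [x]" "[]"] t that by (simp add: tuples_iff)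
      then show ?thesis
        using a t inside n gc[of "M1 @ [a]"] r
        by (simp add: tuples_iff cochain_right[OF f] cochain_right[OF g])
    next
      case (after P M S)
      then have "h (xs @ [x]) = f (P @ g M # S @ [x])" if "x \<in> carrier A" for x
        using h[of P M "S @ [x]"] t that by (simp add: tuples_iff)
      then show ?thesis
        using a t after n gc[of M] r cochain_right[OF f, of "P @ g M # S" a r]
        by (simp add: tuples_iff)
    qed
  qed (use n m in auto)
  then show ?thesis by (simp add: h_def)
qed

lemma circ_cochain:
  assumes f: "f \<in> cochains A E n" and g: "g \<in> cochains A E m" and m: "1 \<le> m"
  shows "circ A n m f g \<in> cochains A E (n + m - 1)"
proof -
  have "circ A n m f g = (\<lambda>xs\<in>tuples A (n + m - 1). \<Oplus>i\<in>{1..n}.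
      (\<lambda>xs\<in>tuples A (n + m - 1).
        signed A ((int i - 1) * (int m - 1)) (circ_i A n m i f g xs)) xs)"
    unfolding circ_def by (rule restrict_ext) simp
  also have "\<dots> \<in> cochains A E (n + m - 1)"
    by (intro cochains_finsum cochains_signed circ_i_cochain[OF f g _ _ m]) auto
  finally show ?thesis .
qed

lemma cochain_bracket_cochain:
  assumes f: "f \<in> cochains A E n" and g: "g \<in> cochains A E m" and "1 \<le> n" "1 \<le> m"
  shows "cochain_bracket A n m f g \<in> cochains A E (n + m - 1)"
proof -
  have c: "circ A n m f g \<in> cochains A E (n + m - 1)" "circ A m n g f \<in> cochains A E (n + m - 1)"
    using circ_cochain[OF f g] circ_cochain[OF g f] assms by (auto simp: add.commute)
  have "cochain_bracket A n m f g = (\<lambda>xs\<in>tuples A (n + m - 1). circ A n m f g xs \<oplus>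
     (\<lambda>xs\<in>tuples A (n + m - 1). \<ominus>
       (\<lambda>xs\<in>tuples A (n + m - 1). signed A ((int n - 1) * (int m - 1)) (circ A m n g f xs)) xs) xs)"
    unfolding cochain_bracket_def a_minus_def by (rule restrict_ext) simp
  then show ?thesis
    using c by (simp add: cochains_add cochains_minus cochains_signed del: restrict_apply)
qed

text \<open>
  The bracket on the direct sum is defined by a \<open>finprod\<close> in the group of cochains, which can only
  be evaluated in a commutative monoid.
\<close>

lemma cochain_group_comm_monoid: "comm_monoid (cochain_group A E n)"
proof (rule comm_monoidI)
  fix f g assume "f \<in> carrier (cochain_group A E n)" "g \<in> carrier (cochain_group A E n)"
  then show "f \<otimes>\<^bsub>cochain_group A E n\<^esub> g \<in> carrier (cochain_group A E n)"
    using cochains_add[of f n g] by (simp add: cochain_group_def)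
next
  show "\<one>\<^bsub>cochain_group A E n\<^esub> \<in> carrier (cochain_group A E n)"
    using cochains_zero[of n] by (simp add: cochain_group_def)
next
  fix f assume "f \<in> carrier (cochain_group A E n)"
  then have f: "f \<in> tuples A n \<rightarrow>\<^sub>E carrier A"
    by (simp add: cochain_group_def cochain_funcset)
  have "(\<lambda>xs\<in>tuples A n. (\<lambda>xs\<in>tuples A n. \<zero>) xs \<oplus> f xs) = (\<lambda>xs\<in>tuples A n. f xs)"
    using PiE_mem[OF f] by (intro restrict_ext) simp
  then show "\<one>\<^bsub>cochain_group A E n\<^esub> \<otimes>\<^bsub>cochain_group A E n\<^esub> f = f"
    using PiE_restrict[OF f] by (simp add: cochain_group_def)
qed (auto simp: cochain_group_def cochain_closed tuples_iff a_ac intro!: restrict_ext)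

lemma hochschild_d_funcset:
  assumes f: "f \<in> cochains A E n"
  shows "hochschild_d A n f \<in> tuples A (Suc n) \<rightarrow>\<^sub>E carrier A"
proof (rule PiE_I)
  fix xs assume xs: "xs \<in> tuples A (Suc n)"
  then obtain a ys where a: "xs = a # ys" by (cases xs) (auto simp: tuples_iff)
  have sub: "set (take k xs) \<subseteq> carrier A" "set (drop k xs) \<subseteq> carrier A" for k
    using xs set_take_subset set_drop_subset unfolding tuples_iff by (metis dual_order.trans)+
  have b: "set (butlast xs) \<subseteq> carrier A" "last xs \<in> carrier A"
    using sub(1)[of "length xs - 1"] xs a last_in_set[of xs] unfolding tuples_iff
    by (auto simp: butlast_conv_take)
  have nth: "xs ! i \<in> carrier A" if "i < Suc n" for i
    using that xs nth_mem[of i xs] by (auto simp: tuples_iff)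
  have "f (take (i - 1) xs @ [xs ! (i - 1) \<otimes> xs ! i] @ drop (i + 1) xs) \<in> carrier A"
    if "i \<in> {1..n}" for i
    by (rule cochain_closed[OF f]) (use sub xs that nth in \<open>auto simp: tuples_iff\<close>)
  moreover have "f (tl xs) \<in> carrier A" "f (butlast xs) \<in> carrier A" "hd xs \<in> carrier A"
    using xs a b by (auto simp: tuples_iff intro!: cochain_closed[OF f])
  ultimately show "hochschild_d A n f xs \<in> carrier A"
    unfolding hochschild_d_def using xs b
    by (simp del: append.simps append_Cons)
qed (simp add: hochschild_d_def)

lemma hochschild_d_zero:
  "hochschild_d A n (\<lambda>xs\<in>tuples A n. \<zero>) = (\<lambda>xs\<in>tuples A (Suc n). \<zero>)"
  unfolding hochschild_d_def
proof (rule restrict_ext)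
  let ?z = "\<lambda>xs\<in>tuples A n. \<zero>"
  fix xs assume xs: "xs \<in> tuples A (Suc n)"
  then obtain a ys where a: "xs = a # ys" by (cases xs) (auto simp: tuples_iff)
  have sub: "set (take k xs) \<subseteq> carrier A" "set (drop k xs) \<subseteq> carrier A" for k
    using xs set_take_subset set_drop_subset unfolding tuples_iff by (metis dual_order.trans)+
  have b: "butlast xs \<in> tuples A n" "last xs \<in> carrier A"
    using sub(1)[of "length xs - 1"] xs a last_in_set[of xs] unfolding tuples_iff
    by (auto simp: butlast_conv_take)
  have nth: "xs ! i \<in> carrier A" if "i < Suc n" for i
    using that xs nth_mem[of i xs] by (auto simp: tuples_iff)
  have "take (i - 1) xs @ [xs ! (i - 1) \<otimes> xs ! i] @ drop (i + 1) xs \<in> tuples A n"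
    if "i \<in> {1..n}" for i
    using sub xs that nth by (auto simp: tuples_iff)
  then have "(\<Oplus>i\<in>{1..n}. signed A (int i)
            (?z (take (i - 1) xs @ [xs ! (i - 1) \<otimes> xs ! i] @ drop (i + 1) xs))) = \<zero>"
    by (intro add.finprod_one_eqI) (simp del: append.simps append_Cons)
  moreover have "tl xs \<in> tuples A n" "hd xs \<in> carrier A"
    using xs a by (auto simp: tuples_iff)
  ultimately show "hd xs \<otimes> ?z (tl xs) \<oplus>
      (\<Oplus>i\<in>{1..n}. signed A (int i)
            (?z (take (i - 1) xs @ [xs ! (i - 1) \<otimes> xs ! i] @ drop (i + 1) xs)))
      \<oplus> signed A (int n + 1) (?z (butlast xs) \<otimes> last xs) = \<zero>"
    using b by simp
qed

lemma zero_in_coboundaries: "(\<lambda>xs\<in>tuples A n. \<zero>) \<in> coboundaries A E n"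
proof (cases n)
  case (Suc m)
  then show ?thesis
    unfolding coboundaries_def using hochschild_d_zero[of m] cochains_zero[of m] by force
qed (simp add: coboundaries_def cochain_group_def)

lemma zero_in_cocycles: "(\<lambda>xs\<in>tuples A n. \<zero>) \<in> cocycles A E n"
  by (simp add: cocycles_def kernel_def cochain_group_def cochains_zero hochschild_d_zero)

lemma coboundaries_funcset: "f \<in> coboundaries A E n \<Longrightarrow> f \<in> tuples A n \<rightarrow>\<^sub>E carrier A"
  by (cases n) (auto simp: coboundaries_def cochain_group_def hochschild_d_funcset[THEN PiE_mem]
      dest: PiE_arb[OF hochschild_d_funcset])

lemma coset_of_zero:
  "coboundaries A E n #>\<^bsub>cochain_group A E n\<^esub> (\<lambda>xs\<in>tuples A n. \<zero>) = coboundaries A E n"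
proof -
  have "(\<lambda>xs\<in>tuples A n. f xs \<oplus> (\<lambda>xs\<in>tuples A n. \<zero>) xs) = f" if "f \<in> coboundaries A E n" for f
  proof -
    have "f xs \<in> carrier A" if "xs \<in> tuples A n" for xs
      using that coboundaries_funcset[OF \<open>f \<in> _\<close>] by auto
    then show ?thesis
      using PiE_restrict[OF coboundaries_funcset[OF that]]
      by (auto simp: fun_eq_iff restrict_def split: if_splits)
  qed
  then show ?thesis by (simp add: r_coset_def cochain_group_def)
qed

lemma in_own_coset:
  assumes "f \<in> cochains A E n"
  shows "f \<in> coboundaries A E n #>\<^bsub>cochain_group A E n\<^esub> f"
proof -
  interpret C: comm_monoid "cochain_group A E n" by (rule cochain_group_comm_monoid)
  have "f = \<one>\<^bsub>cochain_group A E n\<^esub> \<otimes>\<^bsub>cochain_group A E n\<^esub> f"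
    using assms by (intro C.l_one[symmetric]) (simp add: cochain_group_def)
  moreover have "\<one>\<^bsub>cochain_group A E n\<^esub> \<in> coboundaries A E n"
    using zero_in_coboundaries[of n] by (simp add: cochain_group_def)
  ultimately show ?thesis
    unfolding r_coset_def by blast
qed

lemma carrier_HH:
  "carrier (HH A E n) = (\<lambda>f. coboundaries A E n #>\<^bsub>cochain_group A E n\<^esub> f) ` cocycles A E n"
  by (auto simp: HH_def carrier_FactGroup r_coset_def)

lemma one_HH: "\<one>\<^bsub>HH A E n\<^esub> = coboundaries A E n"
  by (simp add: HH_def)

lemma cocycles_subset: "cocycles A E n \<subseteq> cochains A E n"
  by (auto simp: cocycles_def kernel_def cochain_group_def)

text \<open>
  The bracket of two classes is a union over representatives, so a single pair of representatives
  whose bracket is no coboundary keeps it from being the zero class.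
\<close>

lemma HH_bracket_nonzeroI:
  assumes f: "f \<in> cocycles A E a" and g: "g \<in> cocycles A E b" and ab: "1 \<le> a" "1 \<le> b"
    and non: "cochain_bracket A a b f g \<notin> coboundaries A E (a + b - 1)"
  shows "HH_bracket_nonzero A E a b"
proof -
  let ?H = "\<lambda>n f. coboundaries A E n #>\<^bsub>cochain_group A E n\<^esub> f"
  have fg: "f \<in> cochains A E a" "g \<in> cochains A E b"
    using f g cocycles_subset by auto
  have "cochain_bracket A a b f g \<in> HH_bracket A E a b (?H a f) (?H b g)"
    unfolding HH_bracket_def
    using in_own_coset[OF fg(1)] in_own_coset[OF fg(2)]
      in_own_coset[OF cochain_bracket_cochain[OF fg ab]] by blast
  then have "HH_bracket A E a b (?H a f) (?H b g) \<noteq> \<one>\<^bsub>HH A E (a + b - 1)\<^esub>"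
    using non by (auto simp: one_HH)
  then show ?thesis
    unfolding HH_bracket_nonzero_def carrier_HH using f g by blast
qed

lemma cochain_bracket_zero:
  assumes "a + b = Suc N"
  shows "cochain_bracket A a b (\<lambda>xs\<in>tuples A a. \<zero>) (\<lambda>xs\<in>tuples A b. \<zero>) = (\<lambda>xs\<in>tuples A N. \<zero>)"
proof -
  have circ: "circ A c d (\<lambda>xs\<in>tuples A c. \<zero>) (\<lambda>xs\<in>tuples A d. \<zero>) xs = \<zero>"
    if cd: "c + d = Suc N" and xs: "xs \<in> tuples A N" for c d xs
  proof -
    have sub: "set (take k xs) \<subseteq> carrier A" "set (drop k xs) \<subseteq> carrier A" for k
      using xs set_take_subset set_drop_subset unfolding tuples_iff by (metis dual_order.trans)+
    have "circ_i A c d i (\<lambda>xs\<in>tuples A c. \<zero>) (\<lambda>xs\<in>tuples A d. \<zero>) xs = \<zero>" if i: "i \<in> {1..c}" for i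
    proof -
      have "take d (drop (i - 1) xs) \<in> tuples A d"
        using sub(2)[of "i - 1"] set_take_subset[of d "drop (i - 1) xs"] xs cd i
        by (auto simp: tuples_iff)
      moreover have "take (i - 1) xs @ [\<zero>] @ drop (i - 1 + d) xs \<in> tuples A c"
        using sub(1)[of "i - 1"] sub(2)[of "i - 1 + d"] xs cd i by (auto simp: tuples_iff)
      ultimately show ?thesis using xs cd by (simp add: circ_i_def)
    qed
    then show ?thesis
      using xs cd by (auto simp: circ_def intro!: add.finprod_one_eqI)
  qed
  show ?thesis
    using assms circ[of a b] circ[of b a]
    by (auto simp: cochain_bracket_def add.commute a_minus_def intro!: restrict_ext)
qed

text \<open>
  Represent both classes by families of cochains that vanish outside one degree. Then at most one pair of
  degrees contributes to the bracket, which reduces the claim to that of homogeneous classes.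
\<close>

lemma HH_star_bracket_nontrivialI:
  assumes f: "f \<in> cocycles A E a" and g: "g \<in> cocycles A E b" and ab: "1 \<le> a" "1 \<le> b"
    and non: "cochain_bracket A a b f g \<notin> coboundaries A E (a + b - 1)"
  shows "HH_star_bracket_nontrivial A E"
proof -
  let ?H = "\<lambda>n f. coboundaries A E n #>\<^bsub>cochain_group A E n\<^esub> f"
  define z where "z n = (\<lambda>xs\<in>tuples A n. \<zero>)" for n
  define N where "N = a + b - 1"
  \<comment> \<open>The homogeneous cochain \<open>h\<close>, as an element of the direct sum.\<close>
  define pad where "pad c h = (\<lambda>i::nat. if i = c then h else z i)" for c :: nat and h
  define cls where "cls c h = (\<lambda>i. ?H i (pad c h i))" for c h
  have fg: "f \<in> cochains A E a" "g \<in> cochains A E b"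
    using f g cocycles_subset by auto
  have cls_carrier: "cls c h \<in> carrier (HH_star A E)" if h: "h \<in> cocycles A E c" for c h
  proof -
    have pad: "pad c h i \<in> cocycles A E i" for i
      using h zero_in_cocycles by (simp add: pad_def z_def)
    have "{i. cls c h i \<noteq> \<one>\<^bsub>HH A E i\<^esub>} \<subseteq> {c}"
      by (auto simp: cls_def pad_def z_def coset_of_zero one_HH)
    then have "finite {i. cls c h i \<noteq> \<one>\<^bsub>HH A E i\<^esub>}"
      by (rule finite_subset) simp
    moreover have "cls c h i \<in> carrier (HH A E i)" for i
      unfolding carrier_HH cls_def using pad by blast
    ultimately show ?thesis
      unfolding HH_star_def sum_group_def subgroup_generated_def
      by (auto intro!: generate.incl)
  qed
  have cls_mem: "pad c h \<in> Pi UNIV (cls c h)" if "h \<in> cochains A E c" for c h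
    using that cochains_zero in_own_coset by (auto simp: cls_def pad_def z_def)
  interpret C: comm_monoid "cochain_group A E N" by (rule cochain_group_comm_monoid)
  have br: "cochain_bracket A a b f g \<in> carrier (cochain_group A E N)"
    using cochain_bracket_cochain[OF fg ab] by (simp add: cochain_group_def N_def)
  let ?F = "\<lambda>(c, d). cochain_bracket A c d (pad a f c) (pad b g d)"
  let ?I = "{(c, d). c + d = Suc N}"
  have abN: "a + b = Suc N" using ab by (simp add: N_def)
  have zero: "?F cd = \<one>\<^bsub>cochain_group A E N\<^esub>" if "cd \<in> ?I - {(a, b)}" for cd
    using that abN cochain_bracket_zero[of "fst cd" "snd cd" N]
    by (auto simp: pad_def z_def cochain_group_def)
  have Fab: "?F (a, b) = cochain_bracket A a b f g" by (simp add: pad_def)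
  have "?I \<subseteq> {..Suc N} \<times> {..Suc N}" by auto
  then have fin: "finite ?I" by (rule finite_subset) simp
  have "finprod (cochain_group A E N) ?F ?I = finprod (cochain_group A E N) ?F {(a, b)}"
  proof (rule C.finprod_mono_neutral_cong_right[OF fin _ zero])
    show "?F \<in> ?I \<rightarrow> carrier (cochain_group A E N)"
    proof (rule Pi_I)
      fix cd assume "cd \<in> ?I"
      then show "?F cd \<in> carrier (cochain_group A E N)"
        using zero[of cd] br Fab C.one_closed by (cases "cd = (a, b)") (auto simp del: C.one_closed)
    qed
  qed (use abN in auto)
  also have "\<dots> = cochain_bracket A a b f g"
    using br by (simp add: C.finprod_insert pad_def)
  finally have fp: "finprod (cochain_group A E N) ?F ?I = cochain_bracket A a b f g" .
  have "cochain_bracket A a b f g \<in> ?H N (finprod (cochain_group A E N) ?F ?I)"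
    unfolding fp using in_own_coset br by (simp add: cochain_group_def)
  then have "cochain_bracket A a b f g \<in> HH_star_bracket A E (cls a f) (cls b g) N"
    unfolding HH_star_bracket_def using cls_mem[OF fg(1)] cls_mem[OF fg(2)] by blast
  then have "HH_star_bracket A E (cls a f) (cls b g) N \<noteq> \<one>\<^bsub>HH_star A E\<^esub> N"
    using non by (auto simp: HH_star_def one_HH N_def)
  then show ?thesis
    unfolding HH_star_bracket_nontrivial_def using cls_carrier[OF f] cls_carrier[OF g] by metis
qed

lemma alternating_sum_telescopes:
  assumes "S \<in> {0..m} \<rightarrow> carrier A"
  shows "(\<Oplus>i\<in>{1..m}. signed A (int i) (S (i - 1) \<oplus> S i)) = signed A (int m) (S m) \<ominus> S 0"
  using assms
proof (induction m)
  case 0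
  then show ?case by (simp add: signed_def r_neg a_minus_def)
next
  case (Suc m)
  have c: "S i \<in> carrier A" if "i \<le> Suc m" for i
    using Suc.prems that by auto
  have "(\<Oplus>i\<in>{1..Suc m}. signed A (int i) (S (i - 1) \<oplus> S i)) =
      signed A (int (Suc m)) (S m \<oplus> S (Suc m)) \<oplus>
      (\<Oplus>i\<in>{1..m}. signed A (int i) (S (i - 1) \<oplus> S i))"
    using c by (subst atLeastAtMostSuc_conv) (auto intro!: finsum_insert[THEN trans])
  also have "(\<Oplus>i\<in>{1..m}. signed A (int i) (S (i - 1) \<oplus> S i)) = signed A (int m) (S m) \<ominus> S 0"
    using Suc by (auto simp: Pi_def)
  also have "signed A (int (Suc m)) (S m \<oplus> S (Suc m)) =
      \<ominus> signed A (int m) (S m) \<oplus> signed A (int (Suc m)) (S (Suc m))"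
    using c by (simp add: signed_def minus_add)
  also have "\<dots> \<oplus> (signed A (int m) (S m) \<ominus> S 0) = signed A (int (Suc m)) (S (Suc m)) \<ominus> S 0"
    using c by (simp add: a_minus_def a_ac r_neg r_neg1 r_neg2 l_neg del: of_nat_Suc)
  finally show ?case .
qed

text \<open>
  The shape in which products of twisted derivations are cocycles: multiplying two adjacent arguments
  splits the value into two summands, neighbouring positions share a summand, which cancels as
  the signs alternate, and the outermost summands are the two outer terms of the differential.
\<close>

lemma cocycleI_telescoping:
  assumes F: "F \<in> cochains A E m"
    and S: "\<And>xs. xs \<in> tuples A (Suc m) \<Longrightarrow> \<exists>S \<in> {0..m} \<rightarrow> carrier A.
      S 0 = hd xs \<otimes> F (tl xs) \<and> S m = F (butlast xs) \<otimes> last xs \<and>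
      (\<forall>i\<in>{1..m}. F (take (i - 1) xs @ [xs ! (i - 1) \<otimes> xs ! i] @ drop (i + 1) xs) = S (i - 1) \<oplus> S i)"
  shows "F \<in> cocycles A E m"
proof -
  have "hochschild_d A m F = (\<lambda>xs\<in>tuples A (Suc m). \<zero>)"
    unfolding hochschild_d_def
  proof (rule restrict_ext)
    fix xs assume "xs \<in> tuples A (Suc m)"
    then obtain S where S: "S \<in> {0..m} \<rightarrow> carrier A" "hd xs \<otimes> F (tl xs) = S 0"
      "F (butlast xs) \<otimes> last xs = S m"
      "\<And>i. i \<in> {1..m} \<Longrightarrow>
        F (take (i - 1) xs @ [xs ! (i - 1) \<otimes> xs ! i] @ drop (i + 1) xs) = S (i - 1) \<oplus> S i"
      using assms(2) by metis
    have c: "S i \<in> carrier A" if "i \<le> m" for i using S(1) that by auto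
    have "(\<Oplus>i\<in>{1..m}. signed A (int i)
            (F (take (i - 1) xs @ [xs ! (i - 1) \<otimes> xs ! i] @ drop (i + 1) xs))) =
       (\<Oplus>i\<in>{1..m}. signed A (int i) (S (i - 1) \<oplus> S i))"
      using S(4) c by (intro finsum_cong') (auto simp del: append.simps append_Cons)
    also have "\<dots> = signed A (int m) (S m) \<ominus> S 0"
      by (rule alternating_sum_telescopes[OF S(1)])
    finally show "hd xs \<otimes> F (tl xs) \<oplus>
      (\<Oplus>i\<in>{1..m}. signed A (int i)
            (F (take (i - 1) xs @ [xs ! (i - 1) \<otimes> xs ! i] @ drop (i + 1) xs)))
      \<oplus> signed A (int m + 1) (F (butlast xs) \<otimes> last xs) = \<zero>"
      using c unfolding S(2,3) by (simp add: signed_def a_minus_def a_ac r_neg r_neg1 r_neg2)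
  qed
  then show ?thesis
    using F by (simp add: cocycles_def kernel_def cochain_group_def)
qed

end

section \<open>The path algebra\<close>

lemma path_target_Nil [simp]: "path_target Q (x, []) = x"
  by (simp add: path_target_def pre_digraph.awalk_verts.simps)

lemma path_target_Cons [simp]: "path_target Q (x, a # as) = path_target Q (head Q a, as)"
  by (cases as) (simp_all add: path_target_def pre_digraph.awalk_verts.simps)

lemma path_target_append: "path_target Q (x, as @ bs) = path_target Q (path_target Q (x, as), bs)"
  by (induction as arbitrary: x) simp_all

lemma quiver_paths_Nil: "(x, []) \<in> quiver_paths Q \<longleftrightarrow> x \<in> verts Q"
  by (auto simp: quiver_paths_def pre_digraph.awalk_def pre_digraph.cas.simps)

lemma quiver_paths_Cons:
  assumes "fin_digraph Q"
  shows "(x, a # as) \<in> quiver_paths Q \<longleftrightarrow> a \<in> arcs Q \<and> x = tail Q a \<and> (head Q a, as) \<in> quiver_paths Q"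
proof -
  interpret fin_digraph Q by fact
  show ?thesis by (auto simp: quiver_paths_def awalk_Cons_iff)
qed

text \<open>
  A path with \<open>l\<close> arrows has exactly \<open>l + 1\<close> factorisations into two paths, one for each cutting
  position. With this convolution formula, identities in the path algebra can be verified
  coefficientwise.
\<close>

lemma lookup_path_mult:
  "Poly_Mapping.lookup (f \<otimes>\<^bsub>path_algebra Q\<^esub> g) (x, as) =
    (\<Sum>i\<le>length as. Poly_Mapping.lookup f (x, take i as) *
      Poly_Mapping.lookup g (path_target Q (x, take i as), drop i as))"
proof -
  let ?f = "Poly_Mapping.lookup f" and ?g = "Poly_Mapping.lookup g"
  let ?K = "Poly_Mapping.keys f" and ?L = "Poly_Mapping.keys g"
  \<comment> \<open>A pair of paths with product \<open>(x, as)\<close> is met at one cutting position only.\<close>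
  have factor: "(if path_target Q p = path_source q \<and> (fst p, snd p @ snd q) = (x, as) then ?f p * ?g q else 0) =
      (\<Sum>i\<le>length as. if p = (x, take i as) \<and> q = (path_target Q (x, take i as), drop i as)
        then ?f p * ?g q else 0)" (is "_ = (\<Sum>i\<le>length as. ?t i)") for p q
  proof (cases "path_target Q p = path_source q \<and> (fst p, snd p @ snd q) = (x, as)")
    case True
    then have as: "as = snd p @ snd q" and x: "x = fst p" and q: "fst q = path_target Q p"
      by (auto simp: path_source_def)
    have "?t i = (if i = length (snd p) then ?f p * ?g q else 0)" if "i \<le> length as" for i
    proof (cases "i = length (snd p)")
      case True
      then show ?thesis using as x q by (cases p; cases q) auto
    next
      case False
      then have "take i as \<noteq> snd p" using that by (metis length_take min.absorb2)
      then show ?thesis using False by auto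
    qed
    then have "(\<Sum>i\<le>length as. ?t i) = (\<Sum>i\<le>length as. if i = length (snd p) then ?f p * ?g q else 0)"
      by (intro sum.cong) auto
    then show ?thesis using True as by simp
  next
    case False
    then have "?t i = 0" if "i \<le> length as" for i
      by (auto simp: path_source_def)
    then show ?thesis unfolding if_not_P[OF False] by (intro sum.neutral[symmetric]) auto
  qed
  have "Poly_Mapping.lookup (f \<otimes>\<^bsub>path_algebra Q\<^esub> g) (x, as) = (\<Sum>p\<in>?K. \<Sum>q\<in>?L.
      (if path_target Q p = path_source q \<and> (fst p, snd p @ snd q) = (x, as) then ?f p * ?g q else 0))"
    unfolding path_algebra_def monoid.simps ring.simps
    by (auto simp: lookup_sum lookup_single when_def intro!: sum.cong)
  also have "\<dots> = (\<Sum>p\<in>?K. \<Sum>q\<in>?L. \<Sum>i\<le>length as.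
      if p = (x, take i as) \<and> q = (path_target Q (x, take i as), drop i as) then ?f p * ?g q else 0)"
    by (simp only: factor)
  also have "\<dots> = (\<Sum>p\<in>?K. \<Sum>i\<le>length as. \<Sum>q\<in>?L.
      if p = (x, take i as) \<and> q = (path_target Q (x, take i as), drop i as) then ?f p * ?g q else 0)"
    by (intro sum.cong refl sum.swap)
  also have "\<dots> = (\<Sum>i\<le>length as. \<Sum>p\<in>?K. \<Sum>q\<in>?L.
      if p = (x, take i as) \<and> q = (path_target Q (x, take i as), drop i as) then ?f p * ?g q else 0)"
    by (rule sum.swap)
  also have "\<dots> = (\<Sum>i\<le>length as. ?f (x, take i as) * ?g (path_target Q (x, take i as), drop i as))"
  proof (rule sum.cong[OF refl])
    fix i
    let ?p = "(x, take i as)" and ?q = "(path_target Q (x, take i as), drop i as)"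
    have "(\<Sum>p\<in>?K. \<Sum>q\<in>?L. if p = ?p \<and> q = ?q then ?f p * ?g q else 0) =
        (\<Sum>p\<in>?K. if p = ?p then \<Sum>q\<in>?L. if q = ?q then ?f p * ?g q else 0 else 0)"
      by (intro sum.cong refl) auto
    also have "\<dots> = ?f ?p * ?g ?q"
      by (auto simp: in_keys_iff)
    finally show "(\<Sum>p\<in>?K. \<Sum>q\<in>?L. if p = ?p \<and> q = ?q then ?f p * ?g q else 0) = ?f ?p * ?g ?q" .
  qed
  finally show ?thesis .
qed

lemma path_add [simp]: "f \<oplus>\<^bsub>path_algebra Q\<^esub> g = f + g"
  and path_zero [simp]: "\<zero>\<^bsub>path_algebra Q\<^esub> = 0"
  by (simp_all add: path_algebra_def)

lemma path_carrier: "f \<in> carrier (path_algebra Q) \<longleftrightarrow> Poly_Mapping.keys f \<subseteq> quiver_paths Q"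
  by (simp add: path_algebra_def)

lemma path_eqI: "(\<And>x as. Poly_Mapping.lookup f (x, as) = Poly_Mapping.lookup g (x, as)) \<Longrightarrow> f = g"
  by (rule poly_mapping_eqI) auto

lemma path_l_distr: "(f + g) \<otimes>\<^bsub>path_algebra Q\<^esub> h = f \<otimes>\<^bsub>path_algebra Q\<^esub> h + g \<otimes>\<^bsub>path_algebra Q\<^esub> h"
  by (rule path_eqI) (simp add: lookup_path_mult lookup_add distrib_right sum.distrib)

lemma path_r_distr: "h \<otimes>\<^bsub>path_algebra Q\<^esub> (f + g) = h \<otimes>\<^bsub>path_algebra Q\<^esub> f + h \<otimes>\<^bsub>path_algebra Q\<^esub> g"
  by (rule path_eqI) (simp add: lookup_path_mult lookup_add distrib_left sum.distrib)

lemma path_mult_zero [simp]: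
  "0 \<otimes>\<^bsub>path_algebra Q\<^esub> h = 0" "h \<otimes>\<^bsub>path_algebra Q\<^esub> 0 = 0"
  by (rule path_eqI, simp add: lookup_path_mult)+

lemma in_keys_path_mult:
  assumes "r \<in> Poly_Mapping.keys (f \<otimes>\<^bsub>path_algebra Q\<^esub> g)"
  obtains p q where "p \<in> Poly_Mapping.keys f" "q \<in> Poly_Mapping.keys g"
    "path_target Q p = fst q" "r = (fst p, snd p @ snd q)"
proof -
  obtain x as where r: "r = (x, as)" by (cases r)
  have "(\<Sum>i\<le>length as. Poly_Mapping.lookup f (x, take i as) *
      Poly_Mapping.lookup g (path_target Q (x, take i as), drop i as)) \<noteq> 0"
    using assms by (simp add: r in_keys_iff lookup_path_mult)
  then obtain i where "Poly_Mapping.lookup f (x, take i as) \<noteq> 0"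
    "Poly_Mapping.lookup g (path_target Q (x, take i as), drop i as) \<noteq> 0"
    by (metis (no_types, lifting) mult_eq_0_iff sum.neutral)
  then show thesis
    by (intro that[of "(x, take i as)" "(path_target Q (x, take i as), drop i as)"])
      (auto simp: r in_keys_iff)
qed

lemma path_elt_mult:
  assumes "path_target Q p = fst q"
  shows "path_elt p \<otimes>\<^bsub>path_algebra Q\<^esub> path_elt q = path_elt (fst p, snd p @ snd q)"
  using assms by (simp add: path_algebra_def path_elt_def path_source_def)

definition scale :: "'k::field \<Rightarrow> (('v, 'a) path \<Rightarrow>\<^sub>0 'k) \<Rightarrow> (('v, 'a) path \<Rightarrow>\<^sub>0 'k)" where
  "scale c = Poly_Mapping.map ((*) c)"

lemma lookup_scale [simp]: "Poly_Mapping.lookup (scale c f) p = c * Poly_Mapping.lookup f p"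
  by (simp add: scale_def Poly_Mapping.map.rep_eq when_def)

lemma scale_simps [simp]:
  "scale 0 f = 0" "scale c 0 = 0" "scale 1 f = f" "scale c (scale d f) = scale (c * d) f"
  by (rule poly_mapping_eqI, simp)+

lemma scale_add: "scale c (f + g) = scale c f + scale c g"
  by (rule poly_mapping_eqI) (simp add: lookup_add distrib_left)

lemma scale_add_left: "scale (c + d) f = scale c f + scale d f"
  by (rule poly_mapping_eqI) (simp add: lookup_add distrib_right)

lemma scale_mult [simp]:
  "scale c f \<otimes>\<^bsub>path_algebra Q\<^esub> g = scale c (f \<otimes>\<^bsub>path_algebra Q\<^esub> g)"
  "f \<otimes>\<^bsub>path_algebra Q\<^esub> scale c g = scale c (f \<otimes>\<^bsub>path_algebra Q\<^esub> g)"
  by (rule path_eqI, simp add: lookup_path_mult sum_distrib_left mult_ac)+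

lemma keys_scale: "Poly_Mapping.keys (scale c f) \<subseteq> Poly_Mapping.keys f"
  by (auto simp: in_keys_iff)

definition vertex_coeff :: "'v \<Rightarrow> (('v, 'a) path \<Rightarrow>\<^sub>0 'k::field) \<Rightarrow> 'k" where
  "vertex_coeff x f = Poly_Mapping.lookup f (trivial_path x)"

definition arrow_coeff :: "('v, 'a) pre_digraph \<Rightarrow> 'a \<Rightarrow> (('v, 'a) path \<Rightarrow>\<^sub>0 'k::field) \<Rightarrow> 'k" where
  "arrow_coeff Q a f = Poly_Mapping.lookup f (arrows_path Q [a])"

definition ending_part :: "'a \<Rightarrow> (('v, 'a) path \<Rightarrow>\<^sub>0 'k::field) \<Rightarrow> (('v, 'a) path \<Rightarrow>\<^sub>0 'k)" where
  "ending_part a f =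
    Abs_poly_mapping (\<lambda>p. if snd p \<noteq> [] \<and> last (snd p) = a then Poly_Mapping.lookup f p else 0)"

definition left_quotient ::
  "('v, 'a) pre_digraph \<Rightarrow> 'a \<Rightarrow> (('v, 'a) path \<Rightarrow>\<^sub>0 'k::field) \<Rightarrow> (('v, 'a) path \<Rightarrow>\<^sub>0 'k)" where
  "left_quotient Q a f =
    Abs_poly_mapping (\<lambda>p. if fst p = head Q a then Poly_Mapping.lookup f (tail Q a, a # snd p) else 0)"

lemma lookup_ending_part:
  "Poly_Mapping.lookup (ending_part a f) p =
    (if snd p \<noteq> [] \<and> last (snd p) = a then Poly_Mapping.lookup f p else 0)"
proof -
  have "finite {p. (if snd p \<noteq> [] \<and> last (snd p) = a then Poly_Mapping.lookup f p else 0) \<noteq> 0}"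
    by (rule finite_subset[OF _ finite_keys[of f]]) (auto simp: in_keys_iff split: if_splits)
  then show ?thesis by (simp add: ending_part_def)
qed

lemma lookup_left_quotient:
  "Poly_Mapping.lookup (left_quotient Q a f) p =
    (if fst p = head Q a then Poly_Mapping.lookup f (tail Q a, a # snd p) else 0)"
proof -
  have "{p. (if fst p = head Q a then Poly_Mapping.lookup f (tail Q a, a # snd p) else 0) \<noteq> 0} \<subseteq>
      (\<lambda>p. (head Q a, tl (snd p))) ` Poly_Mapping.keys f"
  proof
    fix p assume "p \<in> {p. (if fst p = head Q a then Poly_Mapping.lookup f (tail Q a, a # snd p) else 0) \<noteq> 0}"
    then have "p = (\<lambda>p. (head Q a, tl (snd p))) (tail Q a, a # snd p)"
      "(tail Q a, a # snd p) \<in> Poly_Mapping.keys f"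
      by (auto simp: in_keys_iff prod_eq_iff split: if_splits)
    then show "p \<in> (\<lambda>p. (head Q a, tl (snd p))) ` Poly_Mapping.keys f" by (rule image_eqI)
  qed
  then have "finite {p. (if fst p = head Q a then Poly_Mapping.lookup f (tail Q a, a # snd p) else 0) \<noteq> 0}"
    by (rule finite_subset) simp
  then show ?thesis by (simp add: left_quotient_def)
qed

lemma arrow_coeff_add: "arrow_coeff Q a (f + g) = arrow_coeff Q a f + arrow_coeff Q a g"
  by (simp add: arrow_coeff_def lookup_add)

lemma ending_part_add: "ending_part a (f + g) = ending_part a f + ending_part a g"
  by (rule poly_mapping_eqI) (simp add: lookup_ending_part lookup_add)

lemma left_quotient_add: "left_quotient Q a (f + g) = left_quotient Q a f + left_quotient Q a g"
  by (rule poly_mapping_eqI) (simp add: lookup_left_quotient lookup_add)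

lemma arrow_coeff_mult:
  "arrow_coeff Q a (f \<otimes>\<^bsub>path_algebra Q\<^esub> g) =
    vertex_coeff (tail Q a) f * arrow_coeff Q a g + arrow_coeff Q a f * vertex_coeff (head Q a) g"
  by (simp add: arrow_coeff_def vertex_coeff_def arrows_path_def trivial_path_def lookup_path_mult)

text \<open>
  A product \<open>pq\<close> of paths ends in the arrow \<open>a\<close> either because \<open>q\<close> does, or because \<open>q\<close> is the
  trivial path at the head of \<open>a\<close> and \<open>p\<close> ends in \<open>a\<close>.
\<close>

lemma ending_part_mult:
  "ending_part a (f \<otimes>\<^bsub>path_algebra Q\<^esub> g) =
    f \<otimes>\<^bsub>path_algebra Q\<^esub> ending_part a g + scale (vertex_coeff (head Q a) g) (ending_part a f)"
proof (rule path_eqI)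
  fix x as
  let ?f = "Poly_Mapping.lookup f" and ?g = "Poly_Mapping.lookup g"
  let ?e = "Poly_Mapping.lookup (ending_part a g)"
  have split: "Poly_Mapping.lookup (f \<otimes>\<^bsub>path_algebra Q\<^esub> h) (x, as) =
      (\<Sum>i<length as. ?f (x, take i as) * Poly_Mapping.lookup h (path_target Q (x, take i as), drop i as)) +
      ?f (x, as) * Poly_Mapping.lookup h (path_target Q (x, as), [])" for h
    by (simp add: lookup_path_mult flip: lessThan_Suc_atMost)
  show "Poly_Mapping.lookup (ending_part a (f \<otimes>\<^bsub>path_algebra Q\<^esub> g)) (x, as) =
      Poly_Mapping.lookup (f \<otimes>\<^bsub>path_algebra Q\<^esub> ending_part a g +
        scale (vertex_coeff (head Q a) g) (ending_part a f)) (x, as)"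
  proof (cases "as \<noteq> [] \<and> last as = a")
    case True
    then have "as = butlast as @ [a]" by (metis append_butlast_last_id)
    then have t: "path_target Q (x, as) = head Q a"
      by (metis path_target_append path_target_Cons path_target_Nil)
    have "(\<Sum>i<length as. ?f (x, take i as) * ?g (path_target Q (x, take i as), drop i as)) =
        (\<Sum>i<length as. ?f (x, take i as) * ?e (path_target Q (x, take i as), drop i as))"
      using True by (intro sum.cong) (auto simp: lookup_ending_part)
    then show ?thesis
      using True t by (simp add: lookup_add lookup_ending_part split vertex_coeff_def trivial_path_def)
  next
    case False
    then have "(\<Sum>i<length as. ?f (x, take i as) * ?e (path_target Q (x, take i as), drop i as)) = 0"
      by (intro sum.neutral) (auto simp: lookup_ending_part)
    then show ?thesis
      using False by (auto simp: lookup_add lookup_ending_part split)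
  qed
qed

text \<open>
  A product \<open>pq\<close> of paths begins with the arrow \<open>a\<close> either because \<open>p\<close> does, or because \<open>p\<close> is the
  trivial path at the tail of \<open>a\<close> and \<open>q\<close> begins with \<open>a\<close>.
\<close>

lemma left_quotient_mult:
  "left_quotient Q a (f \<otimes>\<^bsub>path_algebra Q\<^esub> g) =
    left_quotient Q a f \<otimes>\<^bsub>path_algebra Q\<^esub> g + scale (vertex_coeff (tail Q a) f) (left_quotient Q a g)"
proof (rule path_eqI)
  fix x as
  show "Poly_Mapping.lookup (left_quotient Q a (f \<otimes>\<^bsub>path_algebra Q\<^esub> g)) (x, as) =
      Poly_Mapping.lookup (left_quotient Q a f \<otimes>\<^bsub>path_algebra Q\<^esub> g +
        scale (vertex_coeff (tail Q a) f) (left_quotient Q a g)) (x, as)"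
  proof (cases "x = head Q a")
    case True
    have "Poly_Mapping.lookup (f \<otimes>\<^bsub>path_algebra Q\<^esub> g) (tail Q a, a # as) =
        Poly_Mapping.lookup f (tail Q a, []) * Poly_Mapping.lookup g (tail Q a, a # as) +
        (\<Sum>i\<le>length as. Poly_Mapping.lookup f (tail Q a, a # take i as) *
          Poly_Mapping.lookup g (path_target Q (head Q a, take i as), drop i as))"
      by (simp add: lookup_path_mult sum.atMost_Suc_shift del: sum.atMost_Suc)
    then show ?thesis
      using True
      by (simp add: lookup_add lookup_left_quotient lookup_path_mult vertex_coeff_def trivial_path_def)
  qed (simp add: lookup_add lookup_left_quotient lookup_path_mult)
qed

text \<open>
  The factors of the cochains below vanish on the span of the trivial paths; this is why the Leibniz
  rules turn into linearity over this span.
\<close>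

lemma keys_trivialD:
  assumes "Poly_Mapping.keys r \<subseteq> trivial_path ` V"
  shows "arrow_coeff Q a r = 0" "ending_part a r = 0" "left_quotient Q a r = 0"
proof -
  have z: "Poly_Mapping.lookup r (x, b # bs) = 0" for x b bs
    using assms by (force simp: trivial_path_def in_keys_iff)
  then show "arrow_coeff Q a r = 0" "left_quotient Q a r = 0"
    by (auto simp: arrow_coeff_def arrows_path_def lookup_left_quotient intro: poly_mapping_eqI)
  show "ending_part a r = 0"
  proof (rule path_eqI)
    fix x as
    show "Poly_Mapping.lookup (ending_part a r) (x, as) = Poly_Mapping.lookup 0 (x, as)"
      using z by (cases as) (auto simp: lookup_ending_part)
  qed
qed

lemma scale_closed: "f \<in> carrier (path_algebra Q) \<Longrightarrow> scale c f \<in> carrier (path_algebra Q)"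
  using keys_scale by (fastforce simp: path_carrier)

lemma ending_part_closed:
  "f \<in> carrier (path_algebra Q) \<Longrightarrow> ending_part a f \<in> carrier (path_algebra Q)"
  by (auto simp: path_carrier in_keys_iff lookup_ending_part subset_iff)

lemma left_quotient_closed:
  assumes "fin_digraph Q" "f \<in> carrier (path_algebra Q)"
  shows "left_quotient Q a f \<in> carrier (path_algebra Q)"
proof -
  have "(x, as) \<in> quiver_paths Q" if "(x, as) \<in> Poly_Mapping.keys (left_quotient Q a f)" for x as
  proof -
    have "x = head Q a" "(tail Q a, a # as) \<in> Poly_Mapping.keys f"
      using that by (auto simp: in_keys_iff lookup_left_quotient split: if_splits)
    then show ?thesis
      using assms(2) by (auto simp: path_carrier quiver_paths_Cons[OF assms(1)])
  qed
  then show ?thesis by (auto simp: path_carrier)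
qed

section \<open>The cochain of a word of arrows\<close>

text \<open>
  For a word \<open>w\<close> with first and last letter \<open>\<alpha>\<close>, this is the comparison map of resolutions applied to the
  cochain \<open>w \<mapsto> \<alpha>\<close>: on paths, \<open>(u\<alpha>, w\<^sub>2, \<dots>, w\<^bsub>m-1\<^esub>, \<alpha>v)\<close> is sent to \<open>u\<alpha>v\<close>. The arrow \<open>\<alpha>\<close> is
  kept in the first factor and removed from the last one, so that it is not counted twice.
\<close>

definition word_cochain ::
  "('v, 'a) pre_digraph \<Rightarrow> 'a list \<Rightarrow> (('v, 'a) path \<Rightarrow>\<^sub>0 'k::field) list \<Rightarrow> (('v, 'a) path \<Rightarrow>\<^sub>0 'k)" where
  "word_cochain Q w rs =
    scale (\<Prod>i\<in>{1..<length w - 1}. arrow_coeff Q (w ! i) (rs ! i))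
      (ending_part (hd w) (rs ! 0) \<otimes>\<^bsub>path_algebra Q\<^esub> left_quotient Q (last w) (rs ! (length w - 1)))"

lemma nth_in_if_set_subset: "set xs \<subseteq> C \<Longrightarrow> i < length xs \<Longrightarrow> xs ! i \<in> C"
  by (meson nth_mem subsetD)

text \<open>
  Seen as a function of one argument, the cochain involves this argument only through one of its
  three kinds of factors. All properties that concern a single argument are read off from this.
\<close>

lemma word_cochain_split:
  fixes rs ss :: "(('v, 'a) path \<Rightarrow>\<^sub>0 'k::field) list"
  assumes "length rs + 1 + length ss = length w" "2 \<le> length w"
  obtains (first) c v where "rs = []"
      "\<And>r. word_cochain Q w (rs @ r # ss) = scale c (ending_part (hd w) r \<otimes>\<^bsub>path_algebra Q\<^esub> left_quotient Q (last w) v)"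
      "v = last ss"
  | (middle) v where "rs \<noteq> []" "ss \<noteq> []"
      "\<And>r. word_cochain Q w (rs @ r # ss) = scale (arrow_coeff Q (w ! length rs) r) v"
  | (last) c v where "ss = []"
      "\<And>r. word_cochain Q w (rs @ r # ss) = scale c (ending_part (hd w) v \<otimes>\<^bsub>path_algebra Q\<^esub> left_quotient Q (last w) r)"
      "v = hd rs"
proof -
  let ?J = "{1..<length w - 1}"
  let ?c = "\<lambda>r i. arrow_coeff Q (w ! i) ((rs @ r # ss) ! i)"
  have other: "(rs @ r # ss) ! i = (rs @ r' # ss) ! i" if "i \<noteq> length rs" for r r' i
    using that by (auto simp: nth_append nth_Cons')
  have prod: "(\<Prod>i\<in>J. ?c r i) = (\<Prod>i\<in>J. ?c 0 i)" if "length rs \<notin> J" for r J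
    using that by (intro prod.cong refl) (metis other)
  consider "rs = []" "ss \<noteq> []" | "rs \<noteq> []" "ss \<noteq> []" | "rs \<noteq> []" "ss = []"
    using assms by (cases rs; cases ss) auto
  then show thesis
  proof cases
    case 1
    show thesis
    proof (rule first[OF 1(1) _ refl])
      fix r
      have "(r # ss) ! (length w - 1) = List.last ss"
        using 1 assms by (simp add: last_conv_nth flip: assms(1))
      then show "word_cochain Q w (rs @ r # ss) = scale (\<Prod>i\<in>?J. ?c 0 i)
          (ending_part (hd w) r \<otimes>\<^bsub>path_algebra Q\<^esub> left_quotient Q (List.last w) (List.last ss))"
        using prod[of ?J r] 1 by (simp add: word_cochain_def)
    qed
  next
    case 2
    then have J: "length rs \<in> ?J" using assms by (cases rs; cases ss) auto
    show thesis
    proof (rule middle[OF 2])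
      fix r
      have "(\<Prod>i\<in>?J. ?c r i) = arrow_coeff Q (w ! length rs) r * (\<Prod>i\<in>?J - {length rs}. ?c 0 i)"
        using J prod[of "?J - {length rs}" r] by (subst prod.remove[of _ "length rs"]) auto
      moreover have "(rs @ r # ss) ! 0 = (rs @ 0 # ss) ! 0"
        "(rs @ r # ss) ! (length w - 1) = (rs @ 0 # ss) ! (length w - 1)"
        using 2 J by (auto intro!: other)
      ultimately show "word_cochain Q w (rs @ r # ss) = scale (arrow_coeff Q (w ! length rs) r)
          (scale (\<Prod>i\<in>?J - {length rs}. ?c 0 i) (ending_part (hd w) ((rs @ 0 # ss) ! 0) \<otimes>\<^bsub>path_algebra Q\<^esub>
            left_quotient Q (List.last w) ((rs @ 0 # ss) ! (length w - 1))))"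
        by (simp add: word_cochain_def)
    qed
  next
    case 3
    then have l: "length rs = length w - 1" using assms by simp
    show thesis
    proof (rule last[OF 3(2) _ refl])
      fix r
      have "(rs @ r # ss) ! 0 = hd rs" "(rs @ r # ss) ! (length w - 1) = r"
        using 3 l by (auto simp: hd_conv_nth nth_append simp flip: l)
      then show "word_cochain Q w (rs @ r # ss) = scale (\<Prod>i\<in>?J. ?c 0 i)
          (ending_part (hd w) (hd rs) \<otimes>\<^bsub>path_algebra Q\<^esub> left_quotient Q (List.last w) r)"
        using prod[of ?J r] l by (simp add: word_cochain_def)
    qed
  qed
qed

lemma word_cochain_add:
  assumes "length rs + 1 + length ss = length w" "2 \<le> length w"
  shows "word_cochain Q w (rs @ (r + r') # ss) = word_cochain Q w (rs @ r # ss) + word_cochain Q w (rs @ r' # ss)"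
  using assms
  by (cases rule: word_cochain_split[where Q = Q])
    (simp_all add: ending_part_add arrow_coeff_add left_quotient_add path_l_distr path_r_distr scale_add scale_add_left)

text \<open>
  Multiplying an argument on the right by \<open>e\<close> scales by the coefficient of \<open>e\<close> at the head of the
  corresponding letter of \<open>w\<close>, multiplying on the left by that at its tail. For
  composable letters these vertices agree, whence balancedness.
\<close>

lemma word_cochain_mult_vertices_right:
  assumes "length rs + 1 + length ss = length w" "2 \<le> length w" "ss \<noteq> []"
    and e: "Poly_Mapping.keys e \<subseteq> trivial_path ` V"
  shows "word_cochain Q w (rs @ (r \<otimes>\<^bsub>path_algebra Q\<^esub> e) # ss) =
    scale (vertex_coeff (head Q (w ! length rs)) e) (word_cochain Q w (rs @ r # ss))"
  using assms(1,2)
proof (cases rule: word_cochain_split[where Q = Q])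
  case (first c v)
  moreover have "hd w = w ! 0" using assms(2) by (cases w) auto
  ultimately show ?thesis by (simp add: ending_part_mult keys_trivialD[OF e] mult.commute)
next
  case (middle v)
  then show ?thesis by (simp add: arrow_coeff_mult keys_trivialD[OF e] mult.commute)
next
  case (last c v)
  then show ?thesis using assms by simp
qed

lemma word_cochain_mult_vertices_left:
  assumes "length rs + 1 + length ss = length w" "2 \<le> length w" "rs \<noteq> []"
    and e: "Poly_Mapping.keys e \<subseteq> trivial_path ` V"
  shows "word_cochain Q w (rs @ (e \<otimes>\<^bsub>path_algebra Q\<^esub> r) # ss) =
    scale (vertex_coeff (tail Q (w ! length rs)) e) (word_cochain Q w (rs @ r # ss))"
  using assms(1,2)
proof (cases rule: word_cochain_split[where Q = Q])
  case (first c v)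
  then show ?thesis using assms by simp
next
  case (middle v)
  then show ?thesis by (simp add: arrow_coeff_mult keys_trivialD[OF e] mult.commute)
next
  case (last c v)
  then have "length rs = length w - 1" using assms by simp
  then have "List.last w = w ! length rs" using assms(2) by (cases w) (auto simp: last_conv_nth)
  then show ?thesis using last by (simp add: left_quotient_mult keys_trivialD[OF e] mult.commute)
qed

text \<open>
  On tuples of arrows the cochain is the indicator function of the word \<open>w\<close>; it extends the
  cochain \<open>w \<mapsto> hd w\<close> of the minimal resolution.
\<close>

lemma word_cochain_arrows:
  assumes "2 \<le> length w" "length bs = length w" "last w = hd w"
  shows "word_cochain Q w (map (\<lambda>b. path_elt (arrows_path Q [b])) bs) =
    (if bs = w then path_elt (arrows_path Q [hd w]) else (0 :: ('v, 'a) path \<Rightarrow>\<^sub>0 'k::field))"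
proof -
  let ?e = "\<lambda>b. path_elt (arrows_path Q [b]) :: ('v, 'a) path \<Rightarrow>\<^sub>0 'k"
  have c: "arrow_coeff Q a (?e b) = (if a = b then 1 else 0)" for a b
    by (auto simp: arrow_coeff_def path_elt_def arrows_path_def lookup_single when_def)
  have p: "ending_part a (?e b) = (if a = b then ?e b else 0)" for a b
    by (rule poly_mapping_eqI)
      (auto simp: lookup_ending_part path_elt_def arrows_path_def lookup_single when_def)
  have q: "left_quotient Q a (?e b) = (if a = b then path_elt (trivial_path (head Q a)) else 0)" for a b
    by (rule poly_mapping_eqI)
      (auto simp: lookup_left_quotient path_elt_def arrows_path_def trivial_path_def lookup_single when_def)
  have m: "?e b \<otimes>\<^bsub>path_algebra Q\<^esub> path_elt (trivial_path (head Q b)) = ?e b" for b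
    by (subst path_elt_mult) (simp_all add: arrows_path_def trivial_path_def)
  have ne: "w \<noteq> []" using assms(1) by auto
  have ends: "w ! 0 = hd w" "w ! (length w - 1) = hd w"
    using assms(3) hd_conv_nth[OF ne] last_conv_nth[OF ne] by argo+
  have prod: "(\<Prod>i\<in>{1..<length w - 1}. arrow_coeff Q (w ! i) (map ?e bs ! i)) =
      (if \<forall>i\<in>{1..<length w - 1}. bs ! i = w ! i then 1 else 0 :: 'k)"
  proof -
    have "(\<Prod>i\<in>{1..<length w - 1}. arrow_coeff Q (w ! i) (map ?e bs ! i)) =
        (\<Prod>i\<in>{1..<length w - 1}. if bs ! i = w ! i then 1 else 0 :: 'k)"
    proof (rule prod.cong[OF refl])
      fix i assume "i \<in> {1..<length w - 1}"
      then have "i < length bs" using assms(2) unfolding atLeastLessThan_iff by linarith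
      then show "arrow_coeff Q (w ! i) (map ?e bs ! i) = (if bs ! i = w ! i then 1 else 0)"
        by (simp only: nth_map c) (simp only: eq_commute)
    qed
    also have "\<dots> = (if \<forall>i\<in>{1..<length w - 1}. bs ! i = w ! i then 1 else 0)"
    proof (cases "\<forall>i\<in>{1..<length w - 1}. bs ! i = w ! i")
      case True
      then show ?thesis unfolding if_P[OF True] by (intro prod.neutral) simp
    next
      case False
      then obtain i where "i \<in> {1..<length w - 1}" "bs ! i \<noteq> w ! i" by blast
      then show ?thesis
        unfolding if_not_P[OF False] by (intro prod_zero bexI[of _ i]) (simp_all only: if_False finite_atLeastLessThan)
    qed
    finally show ?thesis .
  qed
  have all: "bs = w \<longleftrightarrow> bs ! 0 = hd w \<and> bs ! (length w - 1) = hd w \<and>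
      (\<forall>i\<in>{1..<length w - 1}. bs ! i = w ! i)" (is "_ \<longleftrightarrow> ?rhs")
  proof
    assume ?rhs
    show "bs = w"
    proof (rule nth_equalityI)
      fix i assume "i < length bs"
      then have "i = 0 \<or> (1 \<le> i \<and> i < length w - 1) \<or> i = length w - 1" using assms(2) by linarith
      then consider "i = 0" | "i \<in> {1..<length w - 1}" | "i = length w - 1" unfolding atLeastLessThan_iff by blast
      then show "bs ! i = w ! i" using \<open>?rhs\<close> ends by cases auto
    qed (use assms in simp)
  qed (simp_all only: ends, simp)
  have len: "0 < length bs" "length w - 1 < length bs" using assms by auto
  define P where "P \<longleftrightarrow> (\<forall>i\<in>{1..<length w - 1}. bs ! i = w ! i)"
  show ?thesis
    unfolding word_cochain_def prod nth_map[OF len(1)] nth_map[OF len(2)] p q all assms(3) P_def[symmetric]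
    by (cases "hd w = bs ! 0"; cases "hd w = bs ! (length w - 1)"; cases P) (simp_all add: m)
qed

text \<open>
  For these ideals the minimal bimodule resolution of the quotient is spanned by the chains of arrows
  with consecutive products in \<open>I\<close>, on which the cochains above are modelled.
\<close>

locale quadratic_monomial_algebra = fin_digraph Q
  for Q :: "('v, 'a) pre_digraph" +
  fixes I :: "(('v, 'a) path \<Rightarrow>\<^sub>0 'k::field) set"
  assumes ideal_I: "ideal I (path_algebra Q)"
    and generated_by_paths:
      "\<exists>P \<subseteq> {p \<in> quiver_paths Q. length (snd p) = 2}. I = Idl\<^bsub>path_algebra Q\<^esub> (path_elt ` P)"
begin

abbreviation R :: "(('v, 'a) path \<Rightarrow>\<^sub>0 'k) ring" where
  "R \<equiv> path_algebra Q"

sublocale ideal I R by (rule ideal_I)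

lemma word_cochain_closed:
  assumes "2 \<le> length w" "length rs = length w" "set rs \<subseteq> carrier R"
  shows "word_cochain Q w rs \<in> carrier R"
proof -
  have "rs ! 0 \<in> carrier R" "rs ! (length w - 1) \<in> carrier R"
    using assms(1,2) by (auto intro!: nth_in_if_set_subset[OF assms(3)])
  then show ?thesis
    unfolding word_cochain_def
    by (intro scale_closed m_closed ending_part_closed left_quotient_closed[OF fin_digraph_axioms])
qed

lemma word_cochain_left_linear:
  assumes "2 \<le> length w" "1 + length ss = length w"
    "set ss \<subseteq> carrier R" "r \<in> carrier R" "e \<in> carrier R"
    and e: "Poly_Mapping.keys e \<subseteq> trivial_path ` V"
  shows "word_cochain Q w ((e \<otimes>\<^bsub>R\<^esub> r) # ss) = e \<otimes>\<^bsub>R\<^esub> word_cochain Q w (r # ss)"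
proof -
  have "length ([] :: (('v, 'a) path \<Rightarrow>\<^sub>0 'k) list) + 1 + length ss = length w" using assms by simp
  then show ?thesis using assms(1)
  proof (cases rule: word_cochain_split[where Q = Q])
    case (first c v)
    have "ss \<noteq> []" using assms(1,2) by auto
    then have "v \<in> carrier R"
      using assms(3) last_in_set[of ss] by (auto simp: first(3))
    then have "left_quotient Q (last w) v \<in> carrier R"
      by (rule left_quotient_closed[OF fin_digraph_axioms])
    moreover have "ending_part (hd w) r \<in> carrier R"
      using assms(4) by (rule ending_part_closed)
    ultimately have "e \<otimes>\<^bsub>R\<^esub> ending_part (hd w) r \<otimes>\<^bsub>R\<^esub> left_quotient Q (last w) v =
        e \<otimes>\<^bsub>R\<^esub> (ending_part (hd w) r \<otimes>\<^bsub>R\<^esub> left_quotient Q (last w) v)"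
      by (intro m_assoc assms(5))
    moreover have "ending_part (hd w) (e \<otimes>\<^bsub>R\<^esub> r) = e \<otimes>\<^bsub>R\<^esub> ending_part (hd w) r"
      unfolding ending_part_mult keys_trivialD(2)[OF e] by simp
    ultimately show ?thesis
      using first(2)[of r] first(2)[of "e \<otimes>\<^bsub>R\<^esub> r"] by simp
  next
    case (middle v)
    then show ?thesis by blast
  next
    case (last c v)
    then show ?thesis using assms(1,2) by simp
  qed
qed

lemma word_cochain_right_linear:
  assumes "2 \<le> length w" "length rs + 1 = length w"
    "set rs \<subseteq> carrier R" "r \<in> carrier R" "e \<in> carrier R"
    and e: "Poly_Mapping.keys e \<subseteq> trivial_path ` V"
  shows "word_cochain Q w (rs @ [r \<otimes>\<^bsub>R\<^esub> e]) = word_cochain Q w (rs @ [r]) \<otimes>\<^bsub>R\<^esub> e"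
proof -
  have "length rs + 1 + length ([] :: (('v, 'a) path \<Rightarrow>\<^sub>0 'k) list) = length w" using assms by simp
  then show ?thesis using assms(1)
  proof (cases rule: word_cochain_split[where Q = Q])
    case (last c v)
    have "rs \<noteq> []" using assms(1,2) by auto
    then have "v \<in> carrier R"
      using assms(3) hd_in_set[of rs] by (auto simp: last(3))
    then have "ending_part (hd w) v \<in> carrier R"
      by (rule ending_part_closed)
    moreover have "left_quotient Q (List.last w) r \<in> carrier R"
      using assms(4) by (rule left_quotient_closed[OF fin_digraph_axioms])
    ultimately have "ending_part (hd w) v \<otimes>\<^bsub>R\<^esub> left_quotient Q (List.last w) r \<otimes>\<^bsub>R\<^esub> e =
        ending_part (hd w) v \<otimes>\<^bsub>R\<^esub> (left_quotient Q (List.last w) r \<otimes>\<^bsub>R\<^esub> e)"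
      by (intro m_assoc assms(5))
    moreover have "left_quotient Q (List.last w) (r \<otimes>\<^bsub>R\<^esub> e) = left_quotient Q (List.last w) r \<otimes>\<^bsub>R\<^esub> e"
      unfolding left_quotient_mult keys_trivialD(3)[OF e] by simp
    ultimately show ?thesis
      using last(2)[of r] last(2)[of "r \<otimes>\<^bsub>R\<^esub> e"] by simp
  next
    case (first c v)
    then show ?thesis using assms(1,2) by simp
  next
    case (middle v)
    then show ?thesis by blast
  qed
qed


text \<open>
  The \<open>i\<close>-th member of the telescoping family is obtained from the cochain on \<open>m + 1\<close> arguments by
  reading a vertex coefficient at the \<open>i\<close>-th argument and distributing the letters of \<open>w\<close> over
  the others: the Leibniz rule at position \<open>i\<close> leaves a vertex coefficient in either
  of the two multiplied arguments.
\<close>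

lemma word_cochain_telescopes:
  assumes w: "length w = m" "2 \<le> m" "\<And>i. Suc i < m \<Longrightarrow> head Q (w ! i) = tail Q (w ! Suc i)"
    and rs: "length rs = Suc m" "set rs \<subseteq> carrier R"
  defines "F \<equiv> word_cochain Q w"
  shows "\<exists>S. (\<forall>i\<le>m. S i \<in> carrier R) \<and>
    S 0 = hd rs \<otimes>\<^bsub>R\<^esub> F (tl rs) \<and>
    S m = F (butlast rs) \<otimes>\<^bsub>R\<^esub> last rs \<and>
    (\<forall>i\<in>{1..m}. F (take (i - 1) rs @ [rs ! (i - 1) \<otimes>\<^bsub>R\<^esub> rs ! i] @ drop (i + 1) rs) =
      S (i - 1) + S i)"
proof -
  define c :: "nat \<Rightarrow> (('v, 'a) path \<Rightarrow>\<^sub>0 'k) \<Rightarrow> 'k" where "c j = arrow_coeff Q (w ! j)" for j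
  define rho where "rho r = ending_part (hd w) r" for r :: "('v, 'a) path \<Rightarrow>\<^sub>0 'k"
  define lam where "lam r = left_quotient Q (last w) r" for r :: "('v, 'a) path \<Rightarrow>\<^sub>0 'k"
  have rc: "rs ! i \<in> carrier R" if "i \<le> m" for i
    using rs(1) that by (intro nth_in_if_set_subset[OF rs(2)]) simp
  have rho_closed: "rho (rs ! i) \<in> carrier R" and lam_closed: "lam (rs ! i) \<in> carrier R" if "i \<le> m" for i
    unfolding rho_def lam_def
    by (rule ending_part_closed left_quotient_closed[OF fin_digraph_axioms], rule rc[OF that])+
  have F: "F ys = scale (\<Prod>j\<in>{1..<m - 1}. c j (ys ! j)) (rho (ys ! 0) \<otimes>\<^bsub>R\<^esub> lam (ys ! (m - 1)))" for ys
    unfolding F_def word_cochain_def w(1) c_def rho_def lam_def by (rule refl)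
  \<comment> \<open>Letters before the argument \<open>i\<close> keep their position, later letters move up by one.\<close>
  define C where "C i = (\<Prod>j\<in>{1..<i}. c j (rs ! j)) * vertex_coeff (head Q (w ! (i - 1))) (rs ! i) *
    (\<Prod>j\<in>{i..<m - 1}. c j (rs ! Suc j))" for i
  define S where "S i = (if i = 0 then hd rs \<otimes>\<^bsub>R\<^esub> F (tl rs)
    else if i = m then F (butlast rs) \<otimes>\<^bsub>R\<^esub> last rs
    else scale (C i) (rho (rs ! 0) \<otimes>\<^bsub>R\<^esub> lam (rs ! m)))" for i
  have S0: "S 0 = scale (\<Prod>j\<in>{1..<m - 1}. c j (rs ! Suc j)) ((rs ! 0 \<otimes>\<^bsub>R\<^esub> rho (rs ! 1)) \<otimes>\<^bsub>R\<^esub> lam (rs ! m))"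
  proof -
    have "hd rs = rs ! 0" using rs by (cases rs) auto
    moreover have "(\<Prod>j\<in>{1..<m - 1}. c j (tl rs ! j)) = (\<Prod>j\<in>{1..<m - 1}. c j (rs ! Suc j))"
    proof (rule prod.cong[OF refl])
      fix j assume "j \<in> {1..<m - 1}"
      then have "j < length (tl rs)" using rs(1) unfolding atLeastLessThan_iff length_tl by linarith
      then show "c j (tl rs ! j) = c j (rs ! Suc j)" by (simp only: nth_tl)
    qed
    ultimately show ?thesis
      using rs(1) w(2) m_assoc[OF rc rho_closed lam_closed, of 0 1 m] by (simp add: S_def F nth_tl)
  qed
  have Sm: "S m = scale (\<Prod>j\<in>{1..<m - 1}. c j (rs ! j)) (rho (rs ! 0) \<otimes>\<^bsub>R\<^esub> (lam (rs ! (m - 1)) \<otimes>\<^bsub>R\<^esub> rs ! m))"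
  proof -
    have "last rs = rs ! m" using rs by (cases rs) (auto simp: last_conv_nth)
    moreover have "(\<Prod>j\<in>{1..<m - 1}. c j (butlast rs ! j)) = (\<Prod>j\<in>{1..<m - 1}. c j (rs ! j))"
    proof (rule prod.cong[OF refl])
      fix j assume "j \<in> {1..<m - 1}"
      then have "j < length (butlast rs)" using rs(1) unfolding atLeastLessThan_iff length_butlast by linarith
      then show "c j (butlast rs ! j) = c j (rs ! j)" by (simp only: nth_butlast)
    qed
    ultimately show ?thesis
      using rs(1) w(2) m_assoc[OF rho_closed lam_closed rc, of 0 "m - 1" m] by (simp add: S_def F nth_butlast)
  qed
  have closed: "S i \<in> carrier R" if "i \<le> m" for i
  proof -
    have "scale (C i) (rho (rs ! 0) \<otimes>\<^bsub>R\<^esub> lam (rs ! m)) \<in> carrier R"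
      using rho_closed lam_closed by (intro scale_closed m_closed) auto
    moreover have "S 0 \<in> carrier R" "S m \<in> carrier R"
      unfolding S0 Sm using rho_closed lam_closed rc w(2) by (auto intro!: scale_closed m_closed)
    ultimately show ?thesis by (auto simp: S_def split: if_splits)
  qed
  have contract: "F (take (i - 1) rs @ [rs ! (i - 1) \<otimes>\<^bsub>R\<^esub> rs ! i] @ drop (i + 1) rs) = S (i - 1) + S i"
    if i: "i \<in> {1..m}" for i
  proof -
    define ys where "ys = take (i - 1) rs @ [rs ! (i - 1) \<otimes>\<^bsub>R\<^esub> rs ! i] @ drop (i + 1) rs"
    have len: "length (take (i - Suc 0) rs) = i - Suc 0" using i rs(1) by auto
    have before: "ys ! j = rs ! j" if "j < i - 1" for j
      using that unfolding ys_def by (simp add: nth_append len del: length_take)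
    have at: "ys ! (i - 1) = rs ! (i - 1) \<otimes>\<^bsub>R\<^esub> rs ! i"
      unfolding ys_def by (simp add: nth_append len del: length_take)
    have after: "ys ! j = rs ! Suc j" if "i \<le> j" "j < m" for j
    proof -
      have "i + 1 + (j - (i - 1) - 1) = Suc j" using that i by simp
      then show ?thesis using that i rs(1) by (auto simp: ys_def nth_append nth_Cons')
    qed
    consider "i = 1" | "1 < i" "i < m" | "i = m" "i \<noteq> 1" using i by force
    then have "F ys = S (i - 1) + S i"
    proof cases
      case 1
      have "(\<Prod>j\<in>{1..<m - 1}. c j (ys ! j)) = (\<Prod>j\<in>{1..<m - 1}. c j (rs ! Suc j))"
        by (rule prod.cong) (use after 1 in auto)
      moreover have "ys ! (m - 1) = rs ! m" using after[of "m - 1"] 1 w(2) by simp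
      moreover have "hd w = w ! 0" using w by (cases w) auto
      ultimately show ?thesis
        using at 1 w(2) S0
        by (simp add: F S_def C_def rho_def ending_part_mult path_l_distr scale_add mult.commute)
    next
      case 2
      have J: "{1..<m - 1} = {1..<i - 1} \<union> ({i - 1} \<union> {i..<m - 1})" using 2 by auto
      have "(\<Prod>j\<in>{1..<m - 1}. c j (ys ! j)) =
          (\<Prod>j\<in>{1..<i - 1}. c j (ys ! j)) * (c (i - 1) (ys ! (i - 1)) * (\<Prod>j\<in>{i..<m - 1}. c j (ys ! j)))"
        unfolding J by (subst prod.union_disjoint) (use 2 in auto)
      also have "(\<Prod>j\<in>{1..<i - 1}. c j (ys ! j)) = (\<Prod>j\<in>{1..<i - 1}. c j (rs ! j))"
        by (rule prod.cong) (use before in auto)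
      also have "(\<Prod>j\<in>{i..<m - 1}. c j (ys ! j)) = (\<Prod>j\<in>{i..<m - 1}. c j (rs ! Suc j))"
        by (rule prod.cong) (use after in auto)
      also have "c (i - 1) (ys ! (i - 1)) =
          vertex_coeff (tail Q (w ! (i - 1))) (rs ! (i - 1)) * c (i - 1) (rs ! i) +
          c (i - 1) (rs ! (i - 1)) * vertex_coeff (head Q (w ! (i - 1))) (rs ! i)"
        unfolding at c_def by (rule arrow_coeff_mult)
      \<comment> \<open>Composability of \<open>w\<close> matches the vertex of this summand with the one in \<open>C (i - 1)\<close>.\<close>
      also have "tail Q (w ! (i - 1)) = head Q (w ! (i - 1 - 1))"
        using w(3)[of "i - 1 - 1"] 2 by (simp add: Suc_diff_Suc numeral_2_eq_2)
      finally have prod: "(\<Prod>j\<in>{1..<m - 1}. c j (ys ! j)) = (\<Prod>j\<in>{1..<i - 1}. c j (rs ! j)) *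
          ((vertex_coeff (head Q (w ! (i - 1 - 1))) (rs ! (i - 1)) * c (i - 1) (rs ! i) +
          c (i - 1) (rs ! (i - 1)) * vertex_coeff (head Q (w ! (i - 1))) (rs ! i)) *
          (\<Prod>j\<in>{i..<m - 1}. c j (rs ! Suc j)))" .
      have P: "(\<Prod>j\<in>{1..<m - 1}. c j (ys ! j)) = C (i - 1) + C i"
      proof -
        have "{i - 1..<m - 1} = insert (i - 1) {i..<m - 1}" "{1..<i} = insert (i - 1) {1..<i - 1}"
          using 2 by auto
        then have "C (i - 1) = (\<Prod>j\<in>{1..<i - 1}. c j (rs ! j)) *
            vertex_coeff (head Q (w ! (i - 1 - 1))) (rs ! (i - 1)) *
            (c (i - 1) (rs ! i) * (\<Prod>j\<in>{i..<m - 1}. c j (rs ! Suc j)))"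
          "C i = (c (i - 1) (rs ! (i - 1)) * (\<Prod>j\<in>{1..<i - 1}. c j (rs ! j))) *
            vertex_coeff (head Q (w ! (i - 1))) (rs ! i) * (\<Prod>j\<in>{i..<m - 1}. c j (rs ! Suc j))"
          using 2 by (simp_all add: C_def)
        then show ?thesis unfolding prod by (simp only: algebra_simps)
      qed
      have "ys ! 0 = rs ! 0" "ys ! (m - 1) = rs ! m"
        using before[of 0] after[of "m - 1"] 2 by auto
      moreover have "i - 1 \<noteq> 0" "i - 1 \<noteq> m" "i \<noteq> 0" "i \<noteq> m" using 2 by auto
      ultimately show ?thesis unfolding F P by (simp add: scale_add_left S_def)
    next
      case 3
      have "(\<Prod>j\<in>{1..<m - 1}. c j (ys ! j)) = (\<Prod>j\<in>{1..<m - 1}. c j (rs ! j))"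
        by (rule prod.cong) (use before 3 in auto)
      moreover have "ys ! 0 = rs ! 0" using before[of 0] 3 w(2) by auto
      moreover have "tail Q (last w) = head Q (w ! (m - 1 - 1))"
      proof -
        have "Suc (m - 1 - 1) = m - 1" using w(2) by simp
        moreover have "last w = w ! (m - 1)" using w(1,2) by (cases w) (auto simp: last_conv_nth)
        ultimately show ?thesis using w(3)[of "m - 1 - 1"] w(2) by simp
      qed
      moreover have "S (m - 1) = scale (C (m - 1)) (rho (rs ! 0) \<otimes>\<^bsub>R\<^esub> lam (rs ! m))"
        using w(2) by (auto simp: S_def)
      ultimately show ?thesis
        using at 3 Sm
        by (simp add: F C_def lam_def left_quotient_mult path_r_distr scale_add add.commute)
    qed
    then show ?thesis by (simp only: ys_def)
  qed
  show ?thesis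
    by (rule exI[of _ S]) (use closed contract w(2) in \<open>auto simp: S_def\<close>)
qed

end

section \<open>Descent to the quotient algebra\<close>

context quadratic_monomial_algebra
begin

lemma R_minus: "r \<in> carrier R \<Longrightarrow> \<ominus>\<^bsub>R\<^esub> r = - r"
proof -
  assume r: "r \<in> carrier R"
  then have "- r \<in> carrier R" by (simp add: path_carrier)
  then show ?thesis using r by (intro minus_equality) simp_all
qed

lemma zero_in_ideal: "0 \<in> I"
  using additive_subgroup.zero_closed[OF additive_subgroup_axioms] by simp

lemma ideal_add: "r \<in> I \<Longrightarrow> s \<in> I \<Longrightarrow> r + s \<in> I"
  using additive_subgroup.a_closed[OF additive_subgroup_axioms, of r s] by simp

lemma ideal_scale:
  assumes "r \<in> I"
  shows "scale c r \<in> I"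
proof -
  have r: "r \<in> carrier R" using assms a_subset by blast
  have "scale c \<one>\<^bsub>R\<^esub> \<otimes>\<^bsub>R\<^esub> r \<in> I"
    by (rule I_l_closed[OF assms scale_closed[OF one_closed]])
  then show ?thesis using r by simp
qed

lemma path_elt_closed: "p \<in> quiver_paths Q \<Longrightarrow> path_elt p \<in> carrier R"
  by (simp add: path_carrier path_elt_def)

text \<open>
  The elements of \<open>kQ\<close> supported on paths of \<open>I\<close> with at least two arrows form an ideal that contains the
  generators. Together with its converse \<open>in_idealI\<close> this says that \<open>I\<close> is spanned by paths,
  so that membership can be tested path by path.
\<close>

lemma ideal_keys:
  assumes "r \<in> I" "p \<in> Poly_Mapping.keys r"
  shows "path_elt p \<in> I" "2 \<le> length (snd p)"
proof -
  obtain P where P: "P \<subseteq> {p \<in> quiver_paths Q. length (snd p) = 2}" "I = Idl\<^bsub>R\<^esub> (path_elt ` P)"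
    using generated_by_paths by blast
  define K where "K = {r \<in> carrier R. \<forall>p\<in>Poly_Mapping.keys r. path_elt p \<in> I \<and> 2 \<le> length (snd p)}"
  have gen: "path_elt ` P \<subseteq> I"
    unfolding P(2) using P(1) by (intro genideal_self) (auto intro: path_elt_closed)
  have "ideal K R"
  proof (rule idealI)
    show "ring R" by (rule ring_axioms)
    show "subgroup K (add_monoid R)"
    proof (rule subgroup.intro)
      fix r s assume "r \<in> K" "s \<in> K"
      then have "r + s \<in> carrier R" using add.m_closed[of r s] by (simp add: K_def)
      then show "r \<otimes>\<^bsub>add_monoid R\<^esub> s \<in> K"
        using Poly_Mapping.keys_add[of r s] \<open>r \<in> K\<close> \<open>s \<in> K\<close> by (auto simp: K_def)
    next
      fix r assume "r \<in> K"
      then show "inv\<^bsub>add_monoid R\<^esub> r \<in> K"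
        using R_minus[of r] by (simp add: K_def a_inv_def path_carrier)
    qed (auto simp: K_def path_carrier)
  next
    fix r s assume rs: "r \<in> K" "s \<in> carrier R"
    have "path_elt p \<in> I \<and> 2 \<le> length (snd p)" if "p \<in> Poly_Mapping.keys (s \<otimes>\<^bsub>R\<^esub> r)" for p
      using that
    proof (rule in_keys_path_mult)
      fix q q' assume q: "q \<in> Poly_Mapping.keys s" "q' \<in> Poly_Mapping.keys r"
        "path_target Q q = fst q'" "p = (fst q, snd q @ snd q')"
      then have "path_elt q \<in> carrier R" "path_elt q' \<in> I" "2 \<le> length (snd q')"
        using rs by (auto simp: K_def path_carrier path_elt_def)
      then have "path_elt q \<otimes>\<^bsub>R\<^esub> path_elt q' \<in> I" by (intro I_l_closed)
      then show ?thesis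
        using \<open>2 \<le> length (snd q')\<close> by (simp add: path_elt_mult[OF q(3)] q(4))
    qed
    then show "s \<otimes>\<^bsub>R\<^esub> r \<in> K" using rs by (simp add: K_def)
    have "path_elt p \<in> I \<and> 2 \<le> length (snd p)" if "p \<in> Poly_Mapping.keys (r \<otimes>\<^bsub>R\<^esub> s)" for p
      using that
    proof (rule in_keys_path_mult)
      fix q q' assume q: "q \<in> Poly_Mapping.keys r" "q' \<in> Poly_Mapping.keys s"
        "path_target Q q = fst q'" "p = (fst q, snd q @ snd q')"
      then have "path_elt q' \<in> carrier R" "path_elt q \<in> I" "2 \<le> length (snd q)"
        using rs by (auto simp: K_def path_carrier path_elt_def)
      then have "path_elt q \<otimes>\<^bsub>R\<^esub> path_elt q' \<in> I" by (intro I_r_closed)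
      then show ?thesis
        using \<open>2 \<le> length (snd q)\<close> by (simp add: path_elt_mult[OF q(3)] q(4))
    qed
    then show "r \<otimes>\<^bsub>R\<^esub> s \<in> K" using rs by (simp add: K_def)
  qed
  moreover have "path_elt ` P \<subseteq> K"
    using gen P(1) by (auto simp: K_def path_elt_closed path_elt_def[symmetric]) (auto simp: path_elt_def subset_iff)
  ultimately have "I \<subseteq> K"
    unfolding P(2) by (rule genideal_minimal)
  then show "path_elt p \<in> I" "2 \<le> length (snd p)"
    using assms by (auto simp: K_def)
qed

lemma in_idealI:
  assumes "\<And>p. p \<in> Poly_Mapping.keys r \<Longrightarrow> path_elt p \<in> I"
  shows "r \<in> I"
proof -
  have r: "r = (\<Sum>p\<in>Poly_Mapping.keys r. scale (Poly_Mapping.lookup r p) (path_elt p))"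
    by (rule poly_mapping_eqI)
      (auto simp: lookup_sum path_elt_def lookup_single when_def in_keys_iff if_distrib cong: if_cong)
  have partial: "(\<Sum>p\<in>J. scale (Poly_Mapping.lookup r p) (path_elt p)) \<in> I"
    if "finite J" "J \<subseteq> Poly_Mapping.keys r" for J
    using that
    by (induction J) (auto intro!: zero_in_ideal ideal_add ideal_scale assms)
  from partial[of "Poly_Mapping.keys r"]
  have "(\<Sum>p\<in>Poly_Mapping.keys r. scale (Poly_Mapping.lookup r p) (path_elt p)) \<in> I" by simp
  then show ?thesis by (simp only: r[symmetric])
qed

lemma ending_part_in_ideal: "r \<in> I \<Longrightarrow> ending_part a r \<in> I"
  by (rule in_idealI) (auto simp: in_keys_iff lookup_ending_part split: if_splits intro: ideal_keys(1))

text \<open>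
  The left quotient alone does not preserve \<open>I\<close>: dividing a relation \<open>ab\<close> by \<open>a\<close> leaves an arrow.
  Multiplied by paths that end in \<open>a\<close>, however, it gives back multiples of the paths of \<open>I\<close> from which
  \<open>a\<close> was removed.
\<close>

lemma ending_part_left_quotient_in_ideal:
  assumes "r \<in> I" "s \<in> carrier R"
  shows "ending_part a s \<otimes>\<^bsub>R\<^esub> left_quotient Q a r \<in> I"
proof (rule in_idealI)
  fix p assume "p \<in> Poly_Mapping.keys (ending_part a s \<otimes>\<^bsub>R\<^esub> left_quotient Q a r)"
  then show "path_elt p \<in> I"
  proof (rule in_keys_path_mult)
    fix q q' assume q: "q \<in> Poly_Mapping.keys (ending_part a s)"
      "q' \<in> Poly_Mapping.keys (left_quotient Q a r)" "p = (fst q, snd q @ snd q')"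
    have qs: "q \<in> Poly_Mapping.keys s" and "snd q \<noteq> []" "last (snd q) = a"
      using q(1) by (auto simp: in_keys_iff lookup_ending_part split: if_splits)
    then obtain as where as: "snd q = as @ [a]" by (metis append_butlast_last_id)
    have "q \<in> quiver_paths Q" using qs assms(2) by (auto simp: path_carrier)
    then have w: "awalk (fst q) (as @ [a]) (awlast (fst q) (as @ [a]))"
      unfolding as[symmetric] by (cases q) (auto simp: quiver_paths_def)
    then have path: "(fst q, as) \<in> quiver_paths Q" and tail: "path_target Q (fst q, as) = tail Q a"
      by (auto simp: quiver_paths_def path_target_def awalk_Cons_iff)
    have "(tail Q a, a # snd q') \<in> Poly_Mapping.keys r"
      using q(2) by (auto simp: in_keys_iff lookup_left_quotient split: if_splits)
    then have "path_elt (tail Q a, a # snd q') \<in> I"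
      by (rule ideal_keys(1)[OF assms(1)])
    then have "path_elt (fst q, as) \<otimes>\<^bsub>R\<^esub> path_elt (tail Q a, a # snd q') \<in> I"
      by (rule I_l_closed[OF _ path_elt_closed[OF path]])
    then show ?thesis
      using tail q(3) as by (simp add: path_elt_mult)
  qed
qed

lemma word_cochain_in_ideal:
  assumes "length rs + 1 + length ss = length w" "2 \<le> length w" "last w = hd w"
    "set rs \<subseteq> carrier R" "set ss \<subseteq> carrier R" "b \<in> I"
  shows "word_cochain Q w (rs @ b # ss) \<in> I"
  using assms(1,2)
proof (cases rule: word_cochain_split[where Q = Q])
  case (first c v)
  have "ss \<noteq> []" using assms(1,2) first(1) by auto
  then have "v \<in> carrier R" using assms(5) last_in_set[of ss] by (auto simp: first(3))
  then have "ending_part (hd w) b \<otimes>\<^bsub>R\<^esub> left_quotient Q (last w) v \<in> I"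
    by (intro I_r_closed ending_part_in_ideal assms left_quotient_closed[OF fin_digraph_axioms])
  then show ?thesis unfolding first(2) by (rule ideal_scale)
next
  case (middle v)
  have "arrow_coeff Q (w ! length rs) b = 0"
    using ideal_keys(2)[OF assms(6)] unfolding arrow_coeff_def arrows_path_def
    by (force simp: in_keys_iff)
  then show ?thesis unfolding middle(3) by (simp add: zero_in_ideal)
next
  case (last c v)
  have "rs \<noteq> []" using assms(1,2) last(1) by auto
  then have "v \<in> carrier R" using assms(4) hd_in_set[of rs] by (auto simp: last(3))
  then show ?thesis
    unfolding last(2) assms(3) by (intro ideal_scale ending_part_left_quotient_in_ideal assms)
qed

abbreviation A :: "(('v, 'a) path \<Rightarrow>\<^sub>0 'k) set ring" where
  "A \<equiv> quiver_algebra Q I"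

abbreviation E :: "(('v, 'a) path \<Rightarrow>\<^sub>0 'k) set set" where
  "E \<equiv> vertex_subring Q I"

abbreviation proj :: "(('v, 'a) path \<Rightarrow>\<^sub>0 'k) \<Rightarrow> (('v, 'a) path \<Rightarrow>\<^sub>0 'k) set" where
  "proj r \<equiv> I +>\<^bsub>R\<^esub> r"

lemma carrier_A: "carrier A = proj ` carrier R"
  by (auto simp: quiver_algebra_def FactRing_def A_RCOSETS_def')

lemma vertex_subring_elt:
  assumes "x \<in> E"
  obtains e where "x = proj e" "e \<in> carrier R" "Poly_Mapping.keys e \<subseteq> trivial_path ` verts Q"
proof -
  obtain e where e: "x = proj e" "Poly_Mapping.keys e \<subseteq> trivial_path ` verts Q"
    using assms by (auto simp: vertex_subring_def)
  moreover have "trivial_path ` verts Q \<subseteq> quiver_paths Q"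
    by (auto simp: trivial_path_def quiver_paths_Nil)
  then have "e \<in> carrier R"
    using e(2) unfolding path_carrier by blast
  ultimately show thesis using that by blast
qed

lemma ring_A: "ring A"
  unfolding quiver_algebra_def by (rule quotient_is_ring)

sublocale quotient: ring_with_subset A E
proof (intro ring_with_subset.intro ring_with_subset_axioms.intro ring_A)
  show "E \<subseteq> carrier A"
    by (auto simp: carrier_A elim: vertex_subring_elt)
qed

lemma proj_closed: "r \<in> carrier R \<Longrightarrow> proj r \<in> carrier A"
  by (simp add: carrier_A)

lemma proj_mult: "r \<in> carrier R \<Longrightarrow> s \<in> carrier R \<Longrightarrow> proj r \<otimes>\<^bsub>A\<^esub> proj s = proj (r \<otimes>\<^bsub>R\<^esub> s)"
  using ring_hom_mult[OF rcos_ring_hom, of r s] by (simp add: quiver_algebra_def)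

lemma proj_add: "r \<in> carrier R \<Longrightarrow> s \<in> carrier R \<Longrightarrow> proj r \<oplus>\<^bsub>A\<^esub> proj s = proj (r + s)"
  using ring_hom_add[OF rcos_ring_hom, of r s] by (simp add: quiver_algebra_def)

lemma proj_eq_iff:
  assumes "r \<in> carrier R" "s \<in> carrier R"
  shows "proj r = proj s \<longleftrightarrow> r - s \<in> I"
  using quotient_eq_iff_same_a_r_cos[OF ideal_I assms] assms by (simp add: a_minus_def R_minus)

lemma proj_zero: "proj 0 = \<zero>\<^bsub>A\<^esub>"
proof -
  have "I +>\<^bsub>R\<^esub> \<zero>\<^bsub>R\<^esub> = I"
    using a_coset_add_zero[OF a_subset] by simp
  then show ?thesis by (simp add: quiver_algebra_def FactRing_def)
qed

lemma tuple_of_proj: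
  assumes "xs \<in> tuples A n"
  obtains rs where "xs = map proj rs" "length rs = n" "set rs \<subseteq> carrier R"
proof -
  have "\<forall>x\<in>set xs. \<exists>r. x = proj r \<and> r \<in> carrier R"
    using assms by (auto simp: tuples_iff carrier_A)
  then obtain h where h: "\<And>x. x \<in> set xs \<Longrightarrow> x = proj (h x) \<and> h x \<in> carrier R" by metis
  then have "xs = map proj (map h xs)" by (simp add: map_idI)
  then show thesis
    using assms h by (intro that[of "map h xs"]) (auto simp: tuples_iff)
qed

text \<open>
  An arbitrary representative of a coset; by \<open>word_cochain_descends\<close> below, the choice does not
  matter.
\<close>

definition rep :: "(('v, 'a) path \<Rightarrow>\<^sub>0 'k) set \<Rightarrow> (('v, 'a) path \<Rightarrow>\<^sub>0 'k)" where
  "rep x = (SOME r. r \<in> carrier R \<and> x = proj r)"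

lemma rep_proj:
  assumes "r \<in> carrier R"
  shows "rep (proj r) \<in> carrier R" "proj (rep (proj r)) = proj r"
  using someI[of "\<lambda>s. s \<in> carrier R \<and> proj r = proj s" r] assms by (auto simp: rep_def)

definition quotient_cochain ::
  "'a list \<Rightarrow> (('v, 'a) path \<Rightarrow>\<^sub>0 'k) set list \<Rightarrow> (('v, 'a) path \<Rightarrow>\<^sub>0 'k) set" where
  "quotient_cochain w = (\<lambda>xs\<in>tuples A (length w). proj (word_cochain Q w (map rep xs)))"

text \<open>
  The arguments are exchanged one after the other, from left to right; \<open>ps\<close> collects those that have
  already been exchanged. By additivity, each exchange changes the value by an element of \<open>I\<close>.
\<close>

lemma word_cochain_descends:
  assumes "2 \<le> length w" "last w = hd w"
    and "list_all2 (\<lambda>r s. r \<in> carrier R \<and> s \<in> carrier R \<and> proj r = proj s) rs ss"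
    and "length ps + length rs = length w" "set ps \<subseteq> carrier R"
  shows "proj (word_cochain Q w (ps @ rs)) = proj (word_cochain Q w (ps @ ss))"
  using assms(3-)
proof (induction rs ss arbitrary: ps rule: list_all2_induct)
  case (Cons r rs s ss)
  have rs: "set rs \<subseteq> carrier R" "set ss \<subseteq> carrier R" "length rs = length ss"
    using Cons.hyps(2) by (auto simp: list_all2_conv_all_nth in_set_conv_nth)
  have d: "r - s \<in> I" "r \<in> carrier R" "s \<in> carrier R" using Cons.hyps(1) proj_eq_iff by auto
  have len: "length ps + 1 + length rs = length w" using Cons.prems by simp
  have "word_cochain Q w (ps @ (s + (r - s)) # rs) =
      word_cochain Q w (ps @ s # rs) + word_cochain Q w (ps @ (r - s) # rs)"
    by (rule word_cochain_add[OF len assms(1)])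
  moreover have "word_cochain Q w (ps @ (r - s) # rs) \<in> I"
    by (rule word_cochain_in_ideal[OF len assms(1,2) Cons.prems(2) rs(1) d(1)])
  moreover have "word_cochain Q w (ps @ x # rs) \<in> carrier R" if "x \<in> carrier R" for x
    by (rule word_cochain_closed) (use assms(1) len Cons.prems(2) rs that in auto)
  moreover have "s + (r - s) = r" by simp
  ultimately have "proj (word_cochain Q w (ps @ r # rs)) = proj (word_cochain Q w (ps @ s # rs))"
    using d(2,3) proj_eq_iff by (metis add_diff_cancel_left')
  also have "\<dots> = proj (word_cochain Q w (ps @ s # ss))"
    using Cons.IH[of "ps @ [s]"] Cons.prems d by simp
  finally show ?case .
qed simp

lemma quotient_cochain_proj:
  assumes "2 \<le> length w" "last w = hd w" "length rs = length w" "set rs \<subseteq> carrier R"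
  shows "quotient_cochain w (map proj rs) = proj (word_cochain Q w rs)"
proof -
  have "map proj rs \<in> tuples A (length w)"
    using assms by (auto simp: tuples_iff proj_closed)
  moreover have "list_all2 (\<lambda>r s. r \<in> carrier R \<and> s \<in> carrier R \<and> proj r = proj s)
      (map rep (map proj rs)) rs"
    using assms(4) by (auto simp: list_all2_conv_all_nth rep_proj subset_iff)
  then have "proj (word_cochain Q w ([] @ map rep (map proj rs))) = proj (word_cochain Q w ([] @ rs))"
    by (rule word_cochain_descends[OF assms(1,2)]) (use assms(3) in auto)
  ultimately show ?thesis by (simp add: quotient_cochain_def)
qed

lemma quotient_cochain_cochain:
  assumes w: "2 \<le> length w" "last w = hd w" "\<And>i. Suc i < length w \<Longrightarrow> head Q (w ! i) = tail Q (w ! Suc i)"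
  shows "quotient_cochain w \<in> cochains A E (length w)"
proof (rule quotient.cochainsI)
  note F = quotient_cochain_proj[OF w(1,2)]
  note closed = word_cochain_closed[OF w(1)]
  show "quotient_cochain w \<in> tuples A (length w) \<rightarrow>\<^sub>E carrier A"
  proof (rule PiE_I)
    fix xs assume "xs \<in> tuples A (length w)"
    then show "quotient_cochain w xs \<in> carrier A"
      by (elim tuple_of_proj) (simp add: F closed proj_closed)
  qed (simp add: quotient_cochain_def)
next
  note F = quotient_cochain_proj[OF w(1,2)]
  note closed = word_cochain_closed[OF w(1)]
  fix xs a b ys assume t: "xs @ a # ys \<in> tuples A (length w)" and "a \<in> carrier A" "b \<in> carrier A"
  then obtain r s where rs: "a = proj r" "b = proj s" "r \<in> carrier R" "s \<in> carrier R"
    by (auto simp: carrier_A)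
  obtain ps where ps: "xs = map proj ps" "set ps \<subseteq> carrier R" "length ps = length xs"
    using tuple_of_proj[of xs "length xs"] t by (auto simp: tuples_iff)
  obtain qs where qs: "ys = map proj qs" "set qs \<subseteq> carrier R" "length qs = length ys"
    using tuple_of_proj[of ys "length ys"] t by (auto simp: tuples_iff)
  have len: "length ps + 1 + length qs = length w" using t ps(3) qs(3) by (simp add: tuples_iff)
  have val: "quotient_cochain w (xs @ proj u # ys) = proj (word_cochain Q w (ps @ u # qs))"
    and cl: "word_cochain Q w (ps @ u # qs) \<in> carrier R" if "u \<in> carrier R" for u
    using F[of "ps @ u # qs"] closed[of "ps @ u # qs"] len that ps(2) qs(2) by (simp_all add: ps(1) qs(1))
  have "r + s \<in> carrier R" using add.m_closed[OF rs(3,4)] by simp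
  then show "quotient_cochain w (xs @ (a \<oplus>\<^bsub>A\<^esub> b) # ys) =
      quotient_cochain w (xs @ a # ys) \<oplus>\<^bsub>A\<^esub> quotient_cochain w (xs @ b # ys)"
    using rs by (simp add: proj_add val cl word_cochain_add[OF len w(1)])
next
  note F = quotient_cochain_proj[OF w(1,2)]
  fix xs a b ys e assume t: "xs @ a # b # ys \<in> tuples A (length w)" and "e \<in> E"
  then obtain e' where e: "e = proj e'" "e' \<in> carrier R" "Poly_Mapping.keys e' \<subseteq> trivial_path ` verts Q"
    by (auto elim: vertex_subring_elt)
  obtain r s where rs: "a = proj r" "b = proj s" "r \<in> carrier R" "s \<in> carrier R"
    using t by (auto simp: carrier_A tuples_iff)
  obtain ps where ps: "xs = map proj ps" "set ps \<subseteq> carrier R" "length ps = length xs"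
    using tuple_of_proj[of xs "length xs"] t by (auto simp: tuples_iff)
  obtain qs where qs: "ys = map proj qs" "set qs \<subseteq> carrier R" "length qs = length ys"
    using tuple_of_proj[of ys "length ys"] t by (auto simp: tuples_iff)
  have len: "length ps + 2 + length qs = length w" using t ps(3) qs(3) by (simp add: tuples_iff)
  have val: "quotient_cochain w (xs @ proj u # proj v # ys) = proj (word_cochain Q w (ps @ u # v # qs))"
    if "u \<in> carrier R" "v \<in> carrier R" for u v
    using F[of "ps @ u # v # qs"] len that ps(2) qs(2) by (simp add: ps(1) qs(1))
  have chain: "head Q (w ! length ps) = tail Q (w ! Suc (length ps))" using w(3) len by simp
  have "word_cochain Q w (ps @ (r \<otimes>\<^bsub>R\<^esub> e') # s # qs) =
      scale (vertex_coeff (head Q (w ! length ps)) e') (word_cochain Q w (ps @ r # s # qs))"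
    by (rule word_cochain_mult_vertices_right[OF _ w(1) _ e(3)]) (use len in auto)
  also have "\<dots> = word_cochain Q w (ps @ r # (e' \<otimes>\<^bsub>R\<^esub> s) # qs)"
    using word_cochain_mult_vertices_left[of "ps @ [r]" qs w e' "verts Q" Q s] w(1) len e(3) chain
    by simp
  finally show "quotient_cochain w (xs @ (a \<otimes>\<^bsub>A\<^esub> e) # b # ys) = quotient_cochain w (xs @ a # (e \<otimes>\<^bsub>A\<^esub> b) # ys)"
    using rs e by (simp add: proj_mult val)
next
  note F = quotient_cochain_proj[OF w(1,2)]
  note closed = word_cochain_closed[OF w(1)]
  fix a ys e assume t: "a # ys \<in> tuples A (length w)" and "e \<in> E"
  then obtain e' where e: "e = proj e'" "e' \<in> carrier R" "Poly_Mapping.keys e' \<subseteq> trivial_path ` verts Q"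
    by (auto elim: vertex_subring_elt)
  obtain r where rs: "a = proj r" "r \<in> carrier R"
    using t by (auto simp: carrier_A tuples_iff)
  obtain qs where qs: "ys = map proj qs" "set qs \<subseteq> carrier R" "length qs = length ys"
    using tuple_of_proj[of ys "length ys"] t by (auto simp: tuples_iff)
  have len: "1 + length qs = length w" using t qs(3) by (simp add: tuples_iff)
  have val: "quotient_cochain w (proj u # ys) = proj (word_cochain Q w (u # qs))"
    and cl: "word_cochain Q w (u # qs) \<in> carrier R" if "u \<in> carrier R" for u
    using F[of "u # qs"] closed[of "u # qs"] len that qs(2) by (simp_all add: qs(1))
  show "quotient_cochain w ((e \<otimes>\<^bsub>A\<^esub> a) # ys) = e \<otimes>\<^bsub>A\<^esub> quotient_cochain w (a # ys)"
    using rs e by (simp add: proj_mult val cl word_cochain_left_linear[OF w(1) len qs(2) rs(2) e(2,3)])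
next
  note F = quotient_cochain_proj[OF w(1,2)]
  note closed = word_cochain_closed[OF w(1)]
  fix xs a e assume t: "xs @ [a] \<in> tuples A (length w)" and "e \<in> E"
  then obtain e' where e: "e = proj e'" "e' \<in> carrier R" "Poly_Mapping.keys e' \<subseteq> trivial_path ` verts Q"
    by (auto elim: vertex_subring_elt)
  obtain r where rs: "a = proj r" "r \<in> carrier R"
    using t by (auto simp: carrier_A tuples_iff)
  obtain ps where ps: "xs = map proj ps" "set ps \<subseteq> carrier R" "length ps = length xs"
    using tuple_of_proj[of xs "length xs"] t by (auto simp: tuples_iff)
  have len: "length ps + 1 = length w" using t ps(3) by (simp add: tuples_iff)
  have val: "quotient_cochain w (xs @ [proj u]) = proj (word_cochain Q w (ps @ [u]))"
    and cl: "word_cochain Q w (ps @ [u]) \<in> carrier R" if "u \<in> carrier R" for u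
    using F[of "ps @ [u]"] closed[of "ps @ [u]"] len that ps(2) by (simp_all add: ps(1))
  show "quotient_cochain w (xs @ [a \<otimes>\<^bsub>A\<^esub> e]) = quotient_cochain w (xs @ [a]) \<otimes>\<^bsub>A\<^esub> e"
    using rs e by (simp add: proj_mult val cl word_cochain_right_linear[OF w(1) len ps(2) rs(2) e(2,3)])
qed (use w(1) in auto)

lemma quotient_cochain_cocycle:
  assumes w: "2 \<le> length w" "last w = hd w" "\<And>i. Suc i < length w \<Longrightarrow> head Q (w ! i) = tail Q (w ! Suc i)"
  shows "quotient_cochain w \<in> cocycles A E (length w)"
proof (rule quotient.cocycleI_telescoping[OF quotient_cochain_cochain[OF w]])
  fix xs assume "xs \<in> tuples A (Suc (length w))"
  then obtain rs where rs: "xs = map proj rs" "length rs = Suc (length w)" "set rs \<subseteq> carrier R"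
    by (rule tuple_of_proj)
  let ?F = "word_cochain Q w" and ?m = "length w"
  note F = quotient_cochain_proj[OF w(1,2)]
  obtain S where S: "\<And>i. i \<le> ?m \<Longrightarrow> S i \<in> carrier R" "S 0 = hd rs \<otimes>\<^bsub>R\<^esub> ?F (tl rs)"
    "S ?m = ?F (butlast rs) \<otimes>\<^bsub>R\<^esub> last rs"
    "\<And>i. i \<in> {1..?m} \<Longrightarrow>
      ?F (take (i - 1) rs @ [rs ! (i - 1) \<otimes>\<^bsub>R\<^esub> rs ! i] @ drop (i + 1) rs) = S (i - 1) + S i"
    using word_cochain_telescopes[OF refl w(1,3) rs(2,3)] by blast
  have ne: "rs \<noteq> []" using rs(2) by auto
  have nth: "rs ! i \<in> carrier R" if "i \<le> ?m" for i
    using rs(2) that by (intro nth_in_if_set_subset[OF rs(3)]) simp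
  have tl: "set (tl rs) \<subseteq> carrier R" "length (tl rs) = ?m"
    and bl: "set (butlast rs) \<subseteq> carrier R" "length (butlast rs) = ?m"
    using rs(2,3) list.set_sel(2)[OF ne] by (auto dest: in_set_butlastD)
  show "\<exists>S \<in> {0..?m} \<rightarrow> carrier A. S 0 = hd xs \<otimes>\<^bsub>A\<^esub> quotient_cochain w (tl xs) \<and>
      S ?m = quotient_cochain w (butlast xs) \<otimes>\<^bsub>A\<^esub> last xs \<and>
      (\<forall>i\<in>{1..?m}. quotient_cochain w (take (i - 1) xs @ [xs ! (i - 1) \<otimes>\<^bsub>A\<^esub> xs ! i] @ drop (i + 1) xs) =
        S (i - 1) \<oplus>\<^bsub>A\<^esub> S i)"
  proof (intro bexI[of _ "\<lambda>i. proj (S i)"] conjI ballI)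
    show "(\<lambda>i. proj (S i)) \<in> {0..?m} \<rightarrow> carrier A"
      using S(1) by (auto intro: proj_closed)
    have "hd rs \<in> carrier R" "last rs \<in> carrier R" using ne rs(3) by auto
    then show "proj (S 0) = hd xs \<otimes>\<^bsub>A\<^esub> quotient_cochain w (tl xs)"
      "proj (S ?m) = quotient_cochain w (butlast xs) \<otimes>\<^bsub>A\<^esub> last xs"
      using F[OF tl(2,1)] F[OF bl(2,1)] word_cochain_closed[OF w(1) tl(2,1)]
        word_cochain_closed[OF w(1) bl(2,1)] ne
      by (simp_all add: S(2,3) rs(1) hd_map last_map proj_mult map_tl[symmetric] map_butlast[symmetric])
  next
    fix i assume i: "i \<in> {1..?m}"
    define ys where "ys = take (i - 1) rs @ [rs ! (i - 1) \<otimes>\<^bsub>R\<^esub> rs ! i] @ drop (i + 1) rs"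
    have "take (i - 1) xs @ [xs ! (i - 1) \<otimes>\<^bsub>A\<^esub> xs ! i] @ drop (i + 1) xs = map proj ys"
      using i rs(2) nth[of i] nth[of "i - 1"] by (auto simp: ys_def rs(1) take_map drop_map proj_mult)
    moreover have "length ys = ?m" using i rs(2) by (auto simp: ys_def)
    moreover have "set ys \<subseteq> carrier R"
      using nth[of i] nth[of "i - 1"] i rs(3) set_take_subset[of "i - 1" rs] set_drop_subset[of "i + 1" rs]
      by (auto simp: ys_def)
    moreover have "S i \<in> carrier R" "S (i - 1) \<in> carrier R" using i by (auto intro: S(1))
    ultimately show "quotient_cochain w (take (i - 1) xs @ [xs ! (i - 1) \<otimes>\<^bsub>A\<^esub> xs ! i] @ drop (i + 1) xs) =
        proj (S (i - 1)) \<oplus>\<^bsub>A\<^esub> proj (S i)"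
      using F[of ys] S(4)[OF i, folded ys_def] by (simp add: proj_add)
  qed
qed

definition quotient_coeff :: "('v, 'a) path \<Rightarrow> (('v, 'a) path \<Rightarrow>\<^sub>0 'k) set \<Rightarrow> 'k" where
  "quotient_coeff p x = Poly_Mapping.lookup (rep x) p"

text \<open>
  Since \<open>I\<close> only involves paths with at least two arrows, the coefficients at vertices and arrows are
  well defined on cosets.
\<close>

lemma quotient_coeff_proj:
  assumes "r \<in> carrier R" "length (snd p) \<le> 1"
  shows "quotient_coeff p (proj r) = Poly_Mapping.lookup r p"
proof -
  have "rep (proj r) - r \<in> I" using rep_proj[OF assms(1)] assms(1) by (simp add: proj_eq_iff[symmetric])
  then have "p \<notin> Poly_Mapping.keys (rep (proj r) - r)" using ideal_keys(2) assms(2) by fastforce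
  then show ?thesis by (simp add: quotient_coeff_def in_keys_iff lookup_minus)
qed

end

section \<open>Cocycles that wind around a cycle of relations\<close>

context quadratic_monomial_algebra
begin

lemma proj_eq_zero:
  assumes "r \<in> I"
  shows "proj r = \<zero>\<^bsub>A\<^esub>"
proof -
  have "r \<in> carrier R" "0 \<in> carrier R" using assms a_subset zero_in_ideal by blast+
  then have "proj r = proj 0" using assms by (simp only: proj_eq_iff diff_zero)
  then show ?thesis by (simp only: proj_zero)
qed

lemma quotient_coeff_add:
  assumes "x \<in> carrier A" "y \<in> carrier A" "length (snd p) \<le> 1"
  shows "quotient_coeff p (x \<oplus>\<^bsub>A\<^esub> y) = quotient_coeff p x + quotient_coeff p y"
proof -
  obtain r s where "x = proj r" "y = proj s" "r \<in> carrier R" "s \<in> carrier R"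
    using assms(1,2) by (auto simp: carrier_A)
  moreover from this have "r + s \<in> carrier R" using add.m_closed[of r s] by simp
  ultimately show ?thesis using assms(3) by (simp add: proj_add quotient_coeff_proj lookup_add)
qed

lemma quotient_coeff_zero: "length (snd p) \<le> 1 \<Longrightarrow> quotient_coeff p \<zero>\<^bsub>A\<^esub> = 0"
  using quotient_coeff_proj[of 0 p] by (simp add: proj_zero path_carrier)

lemma quotient_coeff_minus:
  assumes "x \<in> carrier A" "length (snd p) \<le> 1"
  shows "quotient_coeff p (\<ominus>\<^bsub>A\<^esub> x) = - quotient_coeff p x"
  using quotient_coeff_add[of "\<ominus>\<^bsub>A\<^esub> x" x p] assms
  by (simp add: quotient.l_neg quotient_coeff_zero eq_neg_iff_add_eq_0)

lemma quotient_coeff_finsum: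
  assumes "finite J" "\<And>j. j \<in> J \<Longrightarrow> x j \<in> carrier A" "length (snd p) \<le> 1"
  shows "quotient_coeff p (\<Oplus>\<^bsub>A\<^esub>j\<in>J. x j) = (\<Sum>j\<in>J. quotient_coeff p (x j))"
  using assms(1,2)
proof (induction J)
  case (insert j J)
  then show ?case
    using assms(3) by (simp add: quotient.finsum_insert Pi_def quotient_coeff_add)
qed (simp add: quotient_coeff_zero[OF assms(3)])

abbreviation arrow_class :: "'a \<Rightarrow> (('v, 'a) path \<Rightarrow>\<^sub>0 'k) set" where
  "arrow_class b \<equiv> proj (path_elt (arrows_path Q [b]))"

lemma arrow_elt_closed: "b \<in> arcs Q \<Longrightarrow> path_elt (arrows_path Q [b]) \<in> carrier R"
  by (rule path_elt_closed)
    (simp add: arrows_path_def quiver_paths_Cons[OF fin_digraph_axioms] quiver_paths_Nil)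

lemma arrow_class_closed: "b \<in> arcs Q \<Longrightarrow> arrow_class b \<in> carrier A"
  by (rule proj_closed) (rule arrow_elt_closed)

lemma arrow_class_mult_eq_zero:
  assumes "comp_in Q I a b"
  shows "arrow_class a \<otimes>\<^bsub>A\<^esub> arrow_class b = \<zero>\<^bsub>A\<^esub>"
proof -
  have ab: "a \<in> arcs Q" "b \<in> arcs Q" "head Q a = tail Q b" "path_elt (arrows_path Q [a, b]) \<in> I"
    using assms by (auto simp: comp_in_def)
  have "path_elt (arrows_path Q [a]) \<otimes>\<^bsub>R\<^esub> path_elt (arrows_path Q [b]) = path_elt (arrows_path Q [a, b])"
    using ab(3) by (simp add: path_elt_mult arrows_path_def)
  then show ?thesis
    using ab by (simp add: proj_mult arrow_elt_closed proj_eq_zero)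
qed

lemma arrow_coeff_arrow_class:
  "b \<in> arcs Q \<Longrightarrow> quotient_coeff (arrows_path Q [a]) (arrow_class b) = (if a = b then 1 else 0)"
  by (subst quotient_coeff_proj[OF arrow_elt_closed])
    (auto simp: path_elt_def arrows_path_def lookup_single when_def)

text \<open>
  An arrow has only the two factorisations with one trivial factor, so only the trivial path at
  the matching vertex of the other factor contributes.
\<close>

lemma arrow_coeff_arrow_class_mult:
  assumes b: "b \<in> arcs Q" and x: "x \<in> carrier A"
  shows "quotient_coeff (arrows_path Q [b]) (arrow_class b \<otimes>\<^bsub>A\<^esub> x) = quotient_coeff (trivial_path (head Q b)) x"
    and "quotient_coeff (arrows_path Q [b]) (x \<otimes>\<^bsub>A\<^esub> arrow_class b) = quotient_coeff (trivial_path (tail Q b)) x"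
proof -
  obtain r where r: "x = proj r" "r \<in> carrier R" using x by (auto simp: carrier_A)
  let ?b = "path_elt (arrows_path Q [b]) :: ('v, 'a) path \<Rightarrow>\<^sub>0 'k"
  have "arrow_coeff Q b ?b = 1" "vertex_coeff (tail Q b) ?b = 0" "vertex_coeff (head Q b) ?b = 0"
    by (simp_all add: arrow_coeff_def vertex_coeff_def path_elt_def arrows_path_def trivial_path_def
        lookup_single when_def)
  then have "arrow_coeff Q b (?b \<otimes>\<^bsub>R\<^esub> r) = vertex_coeff (head Q b) r"
    "arrow_coeff Q b (r \<otimes>\<^bsub>R\<^esub> ?b) = vertex_coeff (tail Q b) r"
    by (simp_all add: arrow_coeff_mult)
  then show "quotient_coeff (arrows_path Q [b]) (arrow_class b \<otimes>\<^bsub>A\<^esub> x) = quotient_coeff (trivial_path (head Q b)) x"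
    "quotient_coeff (arrows_path Q [b]) (x \<otimes>\<^bsub>A\<^esub> arrow_class b) = quotient_coeff (trivial_path (tail Q b)) x"
    using r arrow_elt_closed[OF b]
    by (simp_all add: proj_mult quotient_coeff_proj arrow_coeff_def vertex_coeff_def arrows_path_def trivial_path_def)
qed

lemma quotient_cochain_arrows:
  assumes "2 \<le> length w" "last w = hd w" "length bs = length w" "set bs \<subseteq> arcs Q"
  shows "quotient_cochain w (map arrow_class bs) = (if bs = w then arrow_class (hd w) else \<zero>\<^bsub>A\<^esub>)"
proof -
  let ?rs = "map (\<lambda>b. path_elt (arrows_path Q [b]) :: ('v, 'a) path \<Rightarrow>\<^sub>0 'k) bs"
  have "set ?rs \<subseteq> carrier R" using assms(4) arrow_elt_closed by auto
  then have "quotient_cochain w (map proj ?rs) = proj (word_cochain Q w ?rs)"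
    using assms by (intro quotient_cochain_proj) auto
  moreover have "map proj ?rs = map arrow_class bs" by simp
  ultimately show ?thesis
    using assms by (simp only: word_cochain_arrows) (simp add: proj_zero)
qed

end

text \<open>
  The cycle is unrolled to a periodic sequence, so that words that run around it several times, starting
  anywhere, are segments of a sequence.
\<close>

locale relation_cycle = quadratic_monomial_algebra Q I
  for Q :: "('v, 'a) pre_digraph" and I :: "(('v, 'a) path \<Rightarrow>\<^sub>0 'k::field) set" +
  fixes a :: "nat \<Rightarrow> 'a" and p :: nat
  assumes p_pos: "0 < p"
    and periodic: "\<And>i. a (i + p) = a i"
    and simple: "inj_on a {..<p}"
    and relation: "\<And>i. comp_in Q I (a i) (a (Suc i))"
begin

definition segment :: "nat \<Rightarrow> nat \<Rightarrow> 'a list" where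
  "segment i m = map a [i..<i + m]"

lemma a_add_mult: "a (i + t * p) = a i"
proof (induction t)
  case (Suc t)
  have "a (i + Suc t * p) = a (i + t * p + p)" by (simp add: algebra_simps)
  then show ?case using Suc by (simp only: periodic)
qed simp

lemma a_mod: "a (i mod p) = a i"
  using a_add_mult[of "i mod p" "i div p"] by simp

lemma a_eq_iff: "a i = a j \<longleftrightarrow> i mod p = j mod p"
proof
  assume "a i = a j"
  then have "a (i mod p) = a (j mod p)" by (simp only: a_mod)
  then show "i mod p = j mod p" using simple p_pos by (simp add: inj_on_def)
qed (metis a_mod)

lemma a_arc: "a i \<in> arcs Q"
  using relation[of i] by (simp add: comp_in_def)

lemma head_a: "head Q (a i) = tail Q (a (Suc i))"
  using relation[of i] by (simp add: comp_in_def)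

lemma length_segment [simp]: "length (segment i m) = m"
  by (simp add: segment_def)

lemma segment_append: "segment i (m + n) = segment i m @ segment (i + m) n"
  using upt_add_eq_append[of i "i + m" n] by (simp add: segment_def add.assoc)

lemma nth_segment: "k < m \<Longrightarrow> segment i m ! k = a (i + k)"
  by (simp add: segment_def)

lemma segment_1: "segment i (Suc 0) = [a i]"
  by (simp add: segment_def)

lemma segment_cong: "i mod p = j mod p \<Longrightarrow> segment i m = segment j m"
proof (rule nth_equalityI)
  fix k assume ij: "i mod p = j mod p" and k: "k < length (segment i m)"
  have "a (i + k) = a (j + k)" unfolding a_eq_iff by (rule mod_add_cong[OF ij refl])
  then show "segment i m ! k = segment j m ! k" using k by (simp add: nth_segment)
qed simp

lemma segment_eq_iff: "0 < m \<Longrightarrow> segment i m = segment j m \<longleftrightarrow> i mod p = j mod p"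
proof
  assume "0 < m" "segment i m = segment j m"
  then have "segment i m ! 0 = segment j m ! 0" by simp
  then show "i mod p = j mod p" using \<open>0 < m\<close> by (simp add: segment_def a_eq_iff)
qed (rule segment_cong)

lemma set_segment: "set (segment i m) \<subseteq> arcs Q"
  using a_arc by (auto simp: segment_def)

abbreviation arrows :: "nat \<Rightarrow> nat \<Rightarrow> (('v, 'a) path \<Rightarrow>\<^sub>0 'k) set list" where
  "arrows i m \<equiv> map arrow_class (segment i m)"

lemma arrows_in_carrier: "set (arrows i m) \<subseteq> carrier A"
  using set_segment by (auto intro: arrow_class_closed)

definition winding_cocycle :: "nat \<Rightarrow> (('v, 'a) path \<Rightarrow>\<^sub>0 'k) set list \<Rightarrow> (('v, 'a) path \<Rightarrow>\<^sub>0 'k) set" where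
  "winding_cocycle t = quotient_cochain (segment 0 (t * p + 1))"

lemma winding_word:
  assumes "1 \<le> t"
  shows "2 \<le> length (segment 0 (t * p + 1))" "hd (segment 0 (t * p + 1)) = a 0"
    "last (segment 0 (t * p + 1)) = a 0"
    "\<And>i. Suc i < length (segment 0 (t * p + 1)) \<Longrightarrow>
      head Q (segment 0 (t * p + 1) ! i) = tail Q (segment 0 (t * p + 1) ! Suc i)"
proof -
  show "2 \<le> length (segment 0 (t * p + 1))" using assms p_pos by (simp add: Suc_le_eq)
  have ne: "segment 0 (t * p + 1) \<noteq> []" by (simp add: segment_def)
  show "hd (segment 0 (t * p + 1)) = a 0" unfolding hd_conv_nth[OF ne] by (simp add: nth_segment)
  show "last (segment 0 (t * p + 1)) = a 0"
    unfolding last_conv_nth[OF ne] using a_add_mult[of 0 t] by (simp add: nth_segment)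
  show "head Q (segment 0 (t * p + 1) ! i) = tail Q (segment 0 (t * p + 1) ! Suc i)"
    if "Suc i < length (segment 0 (t * p + 1))" for i
    using that head_a by (simp add: nth_segment)
qed

lemma winding_cocycle:
  assumes "1 \<le> t"
  shows "winding_cocycle t \<in> cocycles A E (t * p + 1)"
proof -
  have "winding_cocycle t \<in> cocycles A E (length (segment 0 (t * p + 1)))"
    unfolding winding_cocycle_def
    by (intro quotient_cochain_cocycle winding_word[OF assms])
      (simp only: winding_word(2,3)[OF assms])
  then show ?thesis by (simp only: length_segment)
qed

lemma winding_cocycle_arrows:
  assumes "1 \<le> t"
  shows "winding_cocycle t (arrows i (t * p + 1)) = (if p dvd i then arrow_class (a 0) else \<zero>\<^bsub>A\<^esub>)"
proof -
  have "segment i (t * p + 1) = segment 0 (t * p + 1) \<longleftrightarrow> p dvd i"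
    by (subst segment_eq_iff) (auto simp: mod_eq_0_iff_dvd)
  moreover have "winding_cocycle t (arrows i (t * p + 1)) =
      (if segment i (t * p + 1) = segment 0 (t * p + 1) then arrow_class (a 0) else \<zero>\<^bsub>A\<^esub>)"
    unfolding winding_cocycle_def
    using quotient_cochain_arrows[OF winding_word(1)[OF assms], of "segment i (t * p + 1)"]
      winding_word(2,3)[OF assms] set_segment by (simp only: length_segment)
  ultimately show ?thesis by simp
qed

text \<open>
  For \<open>n\<close> congruent to \<open>1\<close> modulo \<open>p\<close>, the segment that starts with \<open>a i\<close> also ends with
  \<open>a i\<close>, and the summand reads off the multiple of this arrow in the value there.
\<close>

definition cycle_trace :: "nat \<Rightarrow> ((('v, 'a) path \<Rightarrow>\<^sub>0 'k) set list \<Rightarrow> (('v, 'a) path \<Rightarrow>\<^sub>0 'k) set) \<Rightarrow> 'k" where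
  "cycle_trace n f = (\<Sum>i<p. quotient_coeff (arrows_path Q [a i]) (f (arrows i n)))"

lemma length_arrow_path [simp]: "length (snd (arrows_path Q [b])) = 1"
  by (simp add: arrows_path_def)

text \<open>
  On consecutive arrows of the cycle all inner terms of the differential vanish. The first term contributes the
  coefficient of \<open>f\<close> at the head of \<open>a i\<close>, on the segment that starts at \<open>i + 1\<close>; the last one
  contributes the coefficient at its tail on the segment that starts at \<open>i\<close>, with a minus sign because
  \<open>f\<close> has even degree. So the sum over the rotations telescopes around the cycle.
\<close>

lemma cycle_trace_coboundary:
  assumes f: "f \<in> cochains A E (u * p)" and even: "even (u * p)"
  shows "cycle_trace (u * p + 1) (hochschild_d A (u * p) f) = 0"
proof -
  define M where "M = u * p"
  define g where "g i = quotient_coeff (trivial_path (tail Q (a i))) (f (arrows i M))" for i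
  have fc: "f (arrows i M) \<in> carrier A" for i
    using quotient.cochain_closed[OF f] arrows_in_carrier by (simp add: M_def)
  have "quotient_coeff (arrows_path Q [a i]) (hochschild_d A M f (arrows i (M + 1))) = g (Suc i) - g i" for i
  proof -
    let ?xs = "arrows i (M + 1)"
    have mem: "?xs \<in> tuples A (Suc M)" using arrows_in_carrier by (simp add: tuples_iff)
    have first: "?xs = arrow_class (a i) # arrows (Suc i) M"
      using segment_append[of i 1 M] by (simp add: segment_1)
    have last: "?xs = arrows i M @ [arrow_class (a (i + M))]"
      using segment_append[of i M 1] by (simp add: segment_1)
    have aM: "a (i + M) = a i" by (simp add: M_def a_add_mult)
    have "f (take (j - 1) ?xs @ [?xs ! (j - 1) \<otimes>\<^bsub>A\<^esub> ?xs ! j] @ drop (j + 1) ?xs) = \<zero>\<^bsub>A\<^esub>"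
      if j: "j \<in> {1..M}" for j
    proof -
      have "?xs ! (j - 1) = arrow_class (a (i + (j - 1)))" "?xs ! j = arrow_class (a (Suc (i + (j - 1))))"
        using j by (auto simp: segment_def nth_append)
      then have "?xs ! (j - 1) \<otimes>\<^bsub>A\<^esub> ?xs ! j = \<zero>\<^bsub>A\<^esub>"
        using arrow_class_mult_eq_zero[OF relation] by simp
      moreover have "f (take (j - 1) ?xs @ \<zero>\<^bsub>A\<^esub> # drop (j + 1) ?xs) = \<zero>\<^bsub>A\<^esub>"
        using j arrows_in_carrier[of i "M + 1"] set_take_subset[of "j - 1" ?xs] set_drop_subset[of "j + 1" ?xs]
        by (intro quotient.cochain_eq_zero[OF f]) (auto simp: M_def[symmetric])
      ultimately show ?thesis by (simp only: append_Cons append_Nil)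
    qed
    then have mid: "(\<Oplus>\<^bsub>A\<^esub>j\<in>{1..M}. signed A (int j)
        (f (take (j - 1) ?xs @ [?xs ! (j - 1) \<otimes>\<^bsub>A\<^esub> ?xs ! j] @ drop (j + 1) ?xs))) = \<zero>\<^bsub>A\<^esub>"
      by (intro quotient.add.finprod_one_eqI) (simp only: quotient.signed_zero)
    have "odd (int M + 1)" using even by (simp add: M_def)
    then have "hochschild_d A M f ?xs = arrow_class (a i) \<otimes>\<^bsub>A\<^esub> f (arrows (Suc i) M) \<oplus>\<^bsub>A\<^esub> \<zero>\<^bsub>A\<^esub>
        \<oplus>\<^bsub>A\<^esub> \<ominus>\<^bsub>A\<^esub> (f (arrows i M) \<otimes>\<^bsub>A\<^esub> arrow_class (a i))"
      unfolding hochschild_d_def restrict_apply'[OF mem] mid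
      by (subst first, subst first, subst last, subst last) (simp add: signed_def aM)
    moreover have "arrow_class (a i) \<otimes>\<^bsub>A\<^esub> f (arrows (Suc i) M) \<in> carrier A"
      "f (arrows i M) \<otimes>\<^bsub>A\<^esub> arrow_class (a i) \<in> carrier A"
      using fc arrow_class_closed[OF a_arc] by simp_all
    ultimately show ?thesis
      using fc by (simp add: quotient_coeff_add quotient_coeff_minus g_def head_a
          arrow_coeff_arrow_class_mult[OF a_arc])
  qed
  then have "cycle_trace (u * p + 1) (hochschild_d A (u * p) f) = (\<Sum>i<p. g (Suc i) - g i)"
    by (simp add: cycle_trace_def M_def)
  also have "\<dots> = g p - g 0" by (rule sum_lessThan_telescope)
  also have "g p = g 0"
    using a_eq_iff[of p 0] segment_cong[of p 0 M] by (simp add: g_def)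
  finally show ?thesis by simp
qed

text \<open>
  The inner cocycle sees a segment that starts at \<open>i + j - 1\<close>, and does not vanish only if this segment
  starts with \<open>a 0\<close>. In that case it shortens \<open>t\<close> rounds and one arrow to this one arrow, and by
  periodicity what is left is again a segment of the cycle, starting at \<open>i\<close>.
\<close>

lemma circ_i_winding:
  assumes "1 \<le> s" "1 \<le> t" and j: "1 \<le> j" "j \<le> s * p + 1"
  shows "circ_i A (s * p + 1) (t * p + 1) j (winding_cocycle s) (winding_cocycle t)
      (arrows i ((s + t) * p + 1)) =
    (if p dvd i \<and> p dvd (j - 1) then arrow_class (a 0) else \<zero>\<^bsub>A\<^esub>)"
proof -
  let ?n = "s * p + 1" and ?m = "t * p + 1" and ?k = "j - 1"
  have len: "(s + t) * p + 1 = ?k + (?m + (?n - j))"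
    using j by (simp add: algebra_simps)
  have split: "arrows i ((s + t) * p + 1) =
      arrows i ?k @ arrows (i + ?k) ?m @ arrows (i + ?k + ?m) (?n - j)"
    unfolding len segment_append by simp
  have inner: "winding_cocycle t (arrows (i + ?k) ?m) =
      (if p dvd (i + ?k) then arrow_class (a 0) else \<zero>\<^bsub>A\<^esub>)"
    by (rule winding_cocycle_arrows[OF assms(2)])
  have "circ_i A ?n ?m j (winding_cocycle s) (winding_cocycle t) (arrows i ((s + t) * p + 1)) =
      winding_cocycle s (arrows i ?k @ winding_cocycle t (arrows (i + ?k) ?m) # arrows (i + ?k + ?m) (?n - j))"
    unfolding split
    by (rule quotient.circ_i_append) (use j arrows_in_carrier in \<open>simp_all only: length_map length_segment\<close>)
  also have "\<dots> = (if p dvd i \<and> p dvd ?k then arrow_class (a 0) else \<zero>\<^bsub>A\<^esub>)"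
  proof (cases "p dvd (i + ?k)")
    case True
    have "a 0 = a (i + ?k)" using True by (simp add: a_eq_iff mod_eq_0_iff_dvd)
    moreover have "segment (i + ?k + ?m) (?n - j) = segment (i + j) (?n - j)"
    proof (rule segment_cong)
      have "i + ?k + ?m = i + j + t * p" using j by simp
      then show "(i + ?k + ?m) mod p = (i + j) mod p" by simp
    qed
    moreover have "segment i ?n = segment i ?k @ a (i + ?k) # segment (i + j) (?n - j)"
    proof -
      have "?n = ?k + (1 + (?n - j))" "i + ?k + 1 = i + j" using j by simp_all
      then show ?thesis by (metis One_nat_def append_Cons append_Nil segment_1 segment_append)
    qed
    ultimately have "arrows i ?k @ arrow_class (a 0) # arrows (i + ?k + ?m) (?n - j) = arrows i ?n"
      by simp
    then have "winding_cocycle s (arrows i ?k @ winding_cocycle t (arrows (i + ?k) ?m) #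
        arrows (i + ?k + ?m) (?n - j)) = winding_cocycle s (arrows i ?n)"
      using True inner by simp
    also have "\<dots> = (if p dvd i then arrow_class (a 0) else \<zero>\<^bsub>A\<^esub>)"
      by (rule winding_cocycle_arrows[OF assms(1)])
    also have "p dvd i \<longleftrightarrow> p dvd i \<and> p dvd ?k" using True by (cases "p dvd i") (simp_all only: dvd_add_right_iff simp_thms)
    finally show ?thesis .
  next
    case False
    have "winding_cocycle s \<in> cochains A E ?n"
      using winding_cocycle[OF assms(1)] quotient.cocycles_subset by blast
    then have "winding_cocycle s (arrows i ?k @ \<zero>\<^bsub>A\<^esub> # arrows (i + ?k + ?m) (?n - j)) = \<zero>\<^bsub>A\<^esub>"
      by (rule quotient.cochain_eq_zero) (use j arrows_in_carrier in simp_all)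
    moreover have "\<not> (p dvd i \<and> p dvd ?k)" using False dvd_add by blast
    ultimately show ?thesis unfolding inner if_not_P[OF False] by (simp only: if_False)
  qed
  finally show ?thesis .
qed

lemma card_multiples: "card {j \<in> {1..s * p + 1}. p dvd (j - 1)} = s + 1"
proof -
  have "{j \<in> {1..s * p + 1}. p dvd (j - 1)} = (\<lambda>k. k * p + 1) ` {..s}"
  proof (intro equalityI subsetI)
    fix j assume "j \<in> {j \<in> {1..s * p + 1}. p dvd (j - 1)}"
    then have "p dvd j - 1" and j: "1 \<le> j" "j - 1 \<le> s * p" by auto
    then obtain k where k: "j - 1 = p * k" by (elim dvdE)
    then have "k \<le> s" using j p_pos by (metis mult.commute mult_le_cancel2)
    then show "j \<in> (\<lambda>k. k * p + 1) ` {..s}" using k j by (intro image_eqI[of _ _ k]) (auto simp: mult.commute)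
  qed auto
  moreover have "inj_on (\<lambda>k. k * p + 1) {..s}" using p_pos by (auto simp: inj_on_def)
  ultimately show ?thesis by (simp add: card_image)
qed

text \<open>
  Among the starting points \<open>i < p\<close> only \<open>i = 0\<close> contributes, and there the insertion succeeds at the
  \<open>s + 1\<close> positions at which the word of the outer cocycle has the letter \<open>a 0\<close>. As \<open>t * p\<close> is even,
  all signs are positive.
\<close>

lemma coeff_circ_winding:
  assumes "1 \<le> s" "1 \<le> t" "even (t * p)" "i < p"
  shows "circ A (s * p + 1) (t * p + 1) (winding_cocycle s) (winding_cocycle t) (arrows i ((s + t) * p + 1)) \<in> carrier A"
    and "quotient_coeff (arrows_path Q [a i])
      (circ A (s * p + 1) (t * p + 1) (winding_cocycle s) (winding_cocycle t) (arrows i ((s + t) * p + 1))) =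
    (if i = 0 then of_nat (s + 1) else 0)"
proof -
  let ?xs = "arrows i ((s + t) * p + 1)" and ?n = "s * p + 1" and ?m = "t * p + 1"
  let ?x = "\<lambda>j. if p dvd i \<and> p dvd (j - 1) then arrow_class (a 0) else \<zero>\<^bsub>A\<^esub>"
  have mem: "?xs \<in> tuples A (?n + ?m - 1)"
    using arrows_in_carrier by (simp add: tuples_iff algebra_simps)
  have xc: "?x j \<in> carrier A" for j using arrow_class_closed[OF a_arc] by simp
  have "circ A ?n ?m (winding_cocycle s) (winding_cocycle t) ?xs =
      (\<Oplus>\<^bsub>A\<^esub>j\<in>{1..?n}. signed A ((int j - 1) * (int ?m - 1))
        (circ_i A ?n ?m j (winding_cocycle s) (winding_cocycle t) ?xs))"
    unfolding circ_def restrict_apply'[OF mem] ..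
  also have "\<dots> = (\<Oplus>\<^bsub>A\<^esub>j\<in>{1..?n}. ?x j)"
  proof (rule quotient.finsum_cong')
    fix j assume "j \<in> {1..?n}"
    then have "circ_i A ?n ?m j (winding_cocycle s) (winding_cocycle t) ?xs = ?x j"
      by (intro circ_i_winding assms) auto
    moreover have "even ((int j - 1) * (int ?m - 1))" using assms(3) by simp
    ultimately show "signed A ((int j - 1) * (int ?m - 1))
        (circ_i A ?n ?m j (winding_cocycle s) (winding_cocycle t) ?xs) = ?x j"
      by (simp only: signed_def if_True)
  qed (use xc in auto)
  finally have c: "circ A ?n ?m (winding_cocycle s) (winding_cocycle t) ?xs = (\<Oplus>\<^bsub>A\<^esub>j\<in>{1..?n}. ?x j)" .
  show "circ A ?n ?m (winding_cocycle s) (winding_cocycle t) ?xs \<in> carrier A"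
    unfolding c using xc by (intro quotient.finsum_closed) auto
  have i0: "p dvd i \<longleftrightarrow> i = 0" using assms(4) by (auto dest: dvd_imp_le)
  have "quotient_coeff (arrows_path Q [a i]) (\<Oplus>\<^bsub>A\<^esub>j\<in>{1..?n}. ?x j) =
      (\<Sum>j\<in>{1..?n}. quotient_coeff (arrows_path Q [a i]) (?x j))"
    by (rule quotient_coeff_finsum) (use xc in auto)
  also have "\<dots> = (\<Sum>j\<in>{1..?n}. if i = 0 \<and> p dvd (j - 1) then 1 else 0)"
    by (rule sum.cong) (auto simp: i0 arrow_coeff_arrow_class[OF a_arc] quotient_coeff_zero)
  also have "\<dots> = (if i = 0 then of_nat (card {j \<in> {1..?n}. p dvd (j - 1)}) else 0)"
    using sum.inter_filter[of "{1..?n}" "\<lambda>_. 1 :: 'k" "\<lambda>j. p dvd (j - 1)"] by (cases "i = 0") simp_all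
  finally show "quotient_coeff (arrows_path Q [a i])
      (circ A ?n ?m (winding_cocycle s) (winding_cocycle t) ?xs) = (if i = 0 then of_nat (s + 1) else 0)"
    unfolding c card_multiples .
qed

lemma cycle_trace_bracket:
  assumes "1 \<le> s" "1 \<le> t" "even (s * p)" "even (t * p)"
  shows "cycle_trace ((s + t) * p + 1)
      (cochain_bracket A (s * p + 1) (t * p + 1) (winding_cocycle s) (winding_cocycle t)) =
    of_nat s - of_nat t"
proof -
  let ?n = "s * p + 1" and ?m = "t * p + 1"
  let ?f = "winding_cocycle s" and ?g = "winding_cocycle t"
  have "quotient_coeff (arrows_path Q [a i]) (cochain_bracket A ?n ?m ?f ?g (arrows i ((s + t) * p + 1))) =
      (if i = 0 then of_nat s - of_nat t else 0)" if i: "i < p" for i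
  proof -
    let ?xs = "arrows i ((s + t) * p + 1)"
    have mem: "?xs \<in> tuples A (?n + ?m - 1)"
      using arrows_in_carrier by (simp add: tuples_iff algebra_simps)
    have st: "(t + s) * p + 1 = (s + t) * p + 1" by (simp add: add.commute)
    note fg = coeff_circ_winding[OF assms(1,2,4) i]
    note gf = coeff_circ_winding[OF assms(2,1,3) i, unfolded st]
    have "even ((int ?n - 1) * (int ?m - 1))" using assms(3) by simp
    then have "cochain_bracket A ?n ?m ?f ?g ?xs = circ A ?n ?m ?f ?g ?xs \<oplus>\<^bsub>A\<^esub> \<ominus>\<^bsub>A\<^esub> circ A ?m ?n ?g ?f ?xs"
      unfolding cochain_bracket_def restrict_apply'[OF mem] a_minus_def by (simp only: signed_def if_True)
    moreover have "\<ominus>\<^bsub>A\<^esub> circ A ?m ?n ?g ?f ?xs \<in> carrier A" using gf(1) by (rule quotient.a_inv_closed)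
    ultimately show ?thesis
      using fg gf by (simp only: quotient_coeff_add quotient_coeff_minus length_arrow_path order_refl) simp
  qed
  then have "cycle_trace ((s + t) * p + 1) (cochain_bracket A ?n ?m ?f ?g) =
      (\<Sum>i<p. if i = 0 then of_nat s - of_nat t else 0)"
    unfolding cycle_trace_def by (intro sum.cong) auto
  then show ?thesis using p_pos by simp
qed

lemma bracket_not_coboundary:
  assumes "CHAR('k) = 0" "1 \<le> s" "1 \<le> t" "even (s * p)" "even (t * p)" "s \<noteq> t"
  shows "cochain_bracket A (s * p + 1) (t * p + 1) (winding_cocycle s) (winding_cocycle t)
    \<notin> coboundaries A E (s * p + 1 + (t * p + 1) - 1)" (is "?b \<notin> _")
proof
  assume "?b \<in> coboundaries A E (s * p + 1 + (t * p + 1) - 1)"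
  moreover have "s * p + 1 + (t * p + 1) - 1 = Suc ((s + t) * p)" by (simp add: algebra_simps)
  ultimately obtain f where f: "f \<in> cochains A E ((s + t) * p)" "?b = hochschild_d A ((s + t) * p) f"
    by (auto simp: coboundaries_def)
  have "even ((s + t) * p)" using assms(4,5) by (auto simp: algebra_simps)
  then have "(of_nat s - of_nat t :: 'k) = 0"
    using cycle_trace_coboundary[OF f(1)] cycle_trace_bracket[OF assms(2-5)] f(2) by simp
  then have "of_nat (max s t - min s t) = (0 :: 'k)"
    by (cases "s \<le> t") (simp_all add: of_nat_diff max_def min_def)
  then have "max s t - min s t = 0" using assms(1) by (simp only: of_nat_eq_0_iff_char_dvd) simp
  then show False using assms(6) by (auto simp: max_def min_def split: if_splits)
qed

lemma bracket_nontrivial: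
  assumes "CHAR('k) = 0" "1 \<le> s" "1 \<le> t" "even (s * p)" "even (t * p)" "s \<noteq> t"
  shows "HH_bracket_nonzero A E (s * p + 1) (t * p + 1)" "HH_star_bracket_nontrivial A E"
  using quotient.HH_bracket_nonzeroI[OF winding_cocycle[OF assms(2)] winding_cocycle[OF assms(3)]]
    quotient.HH_star_bracket_nontrivialI[OF winding_cocycle[OF assms(2)] winding_cocycle[OF assms(3)]]
    bracket_not_coboundary[OF assms] by simp_all

end

section \<open>Cycles from gentle pairs\<close>

lemma (in quadratic_string_algebra) quadratic_monomial: "quadratic_monomial_algebra Q I"
proof (intro quadratic_monomial_algebra.intro quadratic_monomial_algebra_axioms.intro)
  show "ideal I (path_algebra Q)" using admissible_ideal by (simp add: admissible_def)
qed (rule fin_digraph_axioms quadratic_monomial)+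

text \<open>
  \<open>cycle_rot\<close> rotates to the right, \<open>rotate\<close> to the left; since a full rotation is the identity, the
  left rotations are reached with nonnegative powers.
\<close>

lemma cycle_rot_pow_cycle_pair:
  fixes Q :: "('v, 'a) pre_digraph"
  assumes "as \<noteq> []" "k \<le> length as"
  shows "(cycle_rot Q ^^ (length as - k)) (cycle_pair Q as) = cycle_pair Q (rotate k as)"
proof -
  have rot: "(cycle_rot Q ^^ m) (cycle_pair Q (rotate m bs)) = cycle_pair Q bs" if "bs \<noteq> []" for m and bs :: "'a list"
  proof (induction m)
    case (Suc m)
    have "cycle_rot Q (cycle_pair Q (rotate1 cs)) = cycle_pair Q cs" if "cs \<noteq> []" for cs :: "'a list"
      using that by (cases cs) (simp_all add: cycle_rot_def cycle_pair_def arrows_path_def)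
    then have "cycle_rot Q (cycle_pair Q (rotate (Suc m) bs)) = cycle_pair Q (rotate m bs)"
      using that by simp
    then show ?case using Suc by (simp only: funpow_Suc_right comp_def)
  qed simp
  have "rotate (length as - k) (rotate k as) = as"
    using assms(2) by (simp add: rotate_rotate)
  then show ?thesis using rot[of "rotate k as" "length as - k"] assms(1) by simp
qed

text \<open>
  By gentleness of all rotations, each arrow of the cycle has only one successor with which it forms a
  relation. Hence two equal arrows have equal successors, and the unrolled cycle repeats as
  soon as its first arrow comes back: the first return time is a period, it divides \<open>n\<close>, and no two arrows
  within one period coincide.
\<close>

lemma simple_cycle_of_gentle_pair:
  assumes "w \<in> gentle_pairs Q I n"
  obtains a :: "nat \<Rightarrow> 'a" and p where "0 < p" "p dvd n" "\<And>i. a (i + p) = a i" "inj_on a {..<p}"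
    "\<And>i. comp_in Q I (a i) (a (Suc i))"
proof -
  obtain as where as: "w = cycle_pair Q as" "1 \<le> n" "length as = n"
    "\<And>i. Suc i < n \<Longrightarrow> comp_in Q I (as ! i) (as ! Suc i)" "comp_in Q I (last as) (hd as)"
    using assms by (auto simp: gentle_pairs_def cycle_pairs_def)
  have ne: "as \<noteq> []" using as by auto
  define a where "a i = as ! (i mod n)" for i
  have step: "comp_in Q I (a i) (a (Suc i))" for i
  proof (cases "Suc (i mod n) = n")
    case True
    then have "i mod n = n - 1" by simp
    then have "a i = last as" "a (Suc i) = hd as"
      using True by (simp_all add: a_def mod_Suc last_conv_nth[OF ne] hd_conv_nth[OF ne] as(3))
    then show ?thesis using as(5) by simp
  next
    case False
    then have "Suc (i mod n) < n" using as(2) by (metis Suc_lessI mod_less_divisor One_nat_def Suc_le_eq)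
    then show ?thesis using as(4)[of "i mod n"] False by (simp add: a_def mod_Suc)
  qed
  have unique: "b = a (Suc i)" if "comp_in Q I (a i) b" for i b
  proof (rule ccontr)
    assume "b \<noteq> a (Suc i)"
    \<comment> \<open>Rotate such that the cycle starts with the successor of \<open>a i\<close> and ends with \<open>a i\<close>.\<close>
    define k where "k = Suc i mod n"
    have k: "k < n" using as(2) by (simp add: k_def)
    have "cycle_rot_pow Q I n (int (n - k)) w \<in> cycle_pairs0 Q I n"
      using assms by (simp add: gentle_pairs_def)
    then have "cycle_pair Q (rotate k as) \<in> cycle_pairs0 Q I n"
      using cycle_rot_pow_cycle_pair[OF ne, of k Q] k as(1,3) by (simp add: cycle_rot_pow_def nat_diff_distrib)
    then have "\<not> (\<exists>b\<in>arcs Q. b \<noteq> hd (rotate k as) \<and> comp_in Q I (last (rotate k as)) b)"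
      by (simp add: cycle_pairs0_def cycle_pair_def arrows_path_def Let_def)
    moreover have "hd (rotate k as) = a (Suc i)"
      using ne k as(3) by (simp add: hd_rotate_conv_nth a_def k_def)
    moreover have "last (rotate k as) = a i"
    proof -
      have "(k + (n - 1)) mod n = (Suc i + (n - 1)) mod n" by (simp only: k_def mod_add_left_eq)
      also have "Suc i + (n - 1) = i + n" using as(2) by simp
      finally have "(k + (n - 1)) mod n = i mod n" by simp
      then show ?thesis
        using ne as(2,3) nth_rotate[of "n - 1" as k] by (simp add: last_conv_nth a_def add.commute)
    qed
    ultimately show False using that \<open>b \<noteq> a (Suc i)\<close> by (auto simp: comp_in_def)
  qed
  have shift: "a (i + l) = a (j + l)" if "a i = a j" for i j l
  proof (induction l)
    case (Suc l)
    then show ?case using unique[of "i + l" "a (Suc (j + l))"] step[of "j + l"] by simp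
  qed (use that in simp)
  define p where "p = (LEAST p. 0 < p \<and> a p = a 0)"
  have "0 < n \<and> a n = a 0" using as(2) by (simp add: a_def)
  then have p: "0 < p \<and> a p = a 0" unfolding p_def by (rule LeastI)
  have minimal: "q = 0" if "q < p" "a q = a 0" for q
    using not_less_Least[of q "\<lambda>p. 0 < p \<and> a p = a 0"] that by (auto simp: p_def)
  have periodic: "a (i + p) = a i" for i
    using shift[of p 0 i] p by (simp add: add.commute)
  have mult: "a (i + t * p) = a i" for i t
  proof (induction t)
    case (Suc t)
    then show ?case using periodic[of "i + t * p"] by (simp add: algebra_simps)
  qed simp
  show thesis
  proof
    show "0 < p" using p by simp
    show "p dvd n"
    proof -
      have "a (n mod p) = a n" using mult[of "n mod p" "n div p"] by simp
      also have "a n = a 0" by (simp add: a_def)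
      finally have "n mod p = 0" using minimal p by simp
      then show ?thesis by (simp add: dvd_eq_mod_eq_0)
    qed
    show "inj_on a {..<p}"
    proof (rule linorder_inj_onI')
      fix i j assume ij: "i \<in> {..<p}" "j \<in> {..<p}" "i < j"
      show "a i \<noteq> a j"
      proof
        assume "a i = a j"
        then have "a (i + (p - j)) = a 0" using shift[of i j "p - j"] ij p by simp
        then show False using minimal[of "i + (p - j)"] ij by force
      qed
    qed
  qed (rule periodic, rule step)
qed

theorem theorem4p9:
  fixes Q :: "('v, 'a) pre_digraph"
    and I :: "(('v, 'a) path \<Rightarrow>\<^sub>0 'k::alg_closed_field) set"
    and n :: nat
  assumes "CHAR('k) = 0"
    and "quadratic_string_algebra Q I"
    and "n > 0"
    and "gentle_pairs Q I n \<noteq> {}"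
  shows "HH_star_bracket_nontrivial (quiver_algebra Q I) (vertex_subring Q I) \<and>
    (\<forall>s1 s2 :: nat. s1 \<ge> 1 \<longrightarrow> s2 \<ge> 1 \<longrightarrow> s1 \<noteq> s2 \<longrightarrow>
      (even n \<longrightarrow> HH_bracket_nonzero (quiver_algebra Q I) (vertex_subring Q I)
                   (s1 * n + 1) (s2 * n + 1)) \<and>
      (odd n \<longrightarrow> HH_bracket_nonzero (quiver_algebra Q I) (vertex_subring Q I)
                   (2 * s1 * n + 1) (2 * s2 * n + 1)))"
proof -
  obtain w where "w \<in> gentle_pairs Q I n" using assms(4) by blast
  then obtain a p where a: "0 < p" "p dvd n" "\<And>i. a (i + p) = a i" "inj_on a {..<p}"
    "\<And>i. comp_in Q I (a i) (a (Suc i))"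
    by (rule simple_cycle_of_gentle_pair) blast
  interpret quadratic_monomial_algebra Q I
    by (rule quadratic_string_algebra.quadratic_monomial[OF assms(2)])
  interpret relation_cycle Q I a p
    by unfold_locales (fact a)+
  obtain q where q: "n = p * q" using a(2) by (elim dvdE)
  have nontrivial: "HH_bracket_nonzero A E (s * n + 1) (t * n + 1) \<and> HH_star_bracket_nontrivial A E"
    if "1 \<le> s" "1 \<le> t" "even (s * n)" "even (t * n)" "s \<noteq> t" for s t
  proof -
    have eq: "s * n = s * q * p" "t * n = t * q * p" by (simp_all add: q)
    have "1 \<le> q" using assms(3) q by (cases q) auto
    then have "1 \<le> s * q" "1 \<le> t * q" "s * q \<noteq> t * q" using that by (simp_all add: Suc_le_eq)
    then show ?thesis
      using bracket_nontrivial[OF assms(1), of "s * q" "t * q"] that(3,4) unfolding eq by blast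
  qed
  \<comment> \<open>Two different even multiples serve for both parities of \<open>n\<close>.\<close>
  have "HH_star_bracket_nontrivial A E" using nontrivial[of 2 4] by simp
  moreover have "HH_bracket_nonzero A E (s1 * n + 1) (s2 * n + 1)"
    if "1 \<le> s1" "1 \<le> s2" "s1 \<noteq> s2" "even n" for s1 s2
    using nontrivial[of s1 s2] that by simp
  moreover have "HH_bracket_nonzero A E (2 * s1 * n + 1) (2 * s2 * n + 1)"
    if "1 \<le> s1" "1 \<le> s2" "s1 \<noteq> s2" for s1 s2
    using nontrivial[of "2 * s1" "2 * s2"] that by simp
  ultimately show ?thesis by blast
qed

end
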